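(* The problem of deciding whether a finite frame $\mathfrak F=(W,R,R^+,R^-)$ validates the modal formula $\phi_h:=\Diamond(\Box^-t\land\Box^+\neg t)\land(\Diamond^+t\to\Box^+t)$ is $\mathbf P$-hard under logspace many-one reductions.
   Context: Frames have three binary relations $R,R^+,R^-$; $\Diamond,\Box$ are the modalities for $R$, $\Diamond^+,\Box^+$ for $R^+$, and $\Diamond^-,\Box^-$ for $R^-$; $t$ is a propositional variable. A frame validates a formula if it is true at every point under every valuation. *)

theory Defs
  imports Complex_Main
begin

section \<open>Modal logic over frames with three binary relations\<close>

datatype modality = Base | Plus | Minus

datatype 'v fm =
    Var 'v
  | Neg "'v fm"
  | And "'v fm" "'v fm"
  | Imp "'v fm" "'v fm"
  | Dia modality "'v fm"
  | Box modality "'v fm"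

record 'w frame =
  worlds :: "'w set"
  acc :: "modality \<Rightarrow> ('w \<times> 'w) set"

definition is_frame :: "'w frame \<Rightarrow> bool" where
  "is_frame F \<longleftrightarrow> worlds F \<noteq> {} \<and> (\<forall>m. acc F m \<subseteq> worlds F \<times> worlds F)"

primrec holds :: "'w frame \<Rightarrow> ('v \<Rightarrow> 'w set) \<Rightarrow> 'w \<Rightarrow> 'v fm \<Rightarrow> bool" where
  "holds F V w (Var p) \<longleftrightarrow> w \<in> V p"
| "holds F V w (Neg \<phi>) \<longleftrightarrow> \<not> holds F V w \<phi>"
| "holds F V w (And \<phi> \<psi>) \<longleftrightarrow> holds F V w \<phi> \<and> holds F V w \<psi>"
| "holds F V w (Imp \<phi> \<psi>) \<longleftrightarrow> (holds F V w \<phi> \<longrightarrow> holds F V w \<psi>)"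
| "holds F V w (Dia m \<phi>) \<longleftrightarrow> (\<exists>v. (w, v) \<in> acc F m \<and> holds F V v \<phi>)"
| "holds F V w (Box m \<phi>) \<longleftrightarrow> (\<forall>v. (w, v) \<in> acc F m \<longrightarrow> holds F V v \<phi>)"

definition validates :: "'w frame \<Rightarrow> 'v fm \<Rightarrow> bool" where
  "validates F \<phi> \<longleftrightarrow> (\<forall>V. (\<forall>p. V p \<subseteq> worlds F) \<longrightarrow> (\<forall>w\<in>worlds F. holds F V w \<phi>))"

definition phi_h :: "'v \<Rightarrow> 'v fm" where
  "phi_h t =
     And (Dia Base (And (Box Minus (Var t)) (Box Plus (Neg (Var t)))))
         (Imp (Dia Plus (Var t)) (Box Plus (Var t)))"


section \<open>Validity on finite frames as a language\<close>

text \<open>A finite frame is presented, up to isomorphism, with worlds \<open>0, \<dots>, n - 1\<close>. It is encoded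
  by \<open>n\<close> in unary, a separator, and the three \<open>n \<times> n\<close> adjacency matrices, row by row.\<close>

definition matrix_bits :: "nat \<Rightarrow> (nat \<times> nat) set \<Rightarrow> bool list" where
  "matrix_bits n r = concat (map (\<lambda>i. map (\<lambda>j. (i, j) \<in> r) [0..<n]) [0..<n])"

definition encode_frame :: "nat frame \<Rightarrow> bool list" where
  "encode_frame F = (let n = card (worlds F) in
     replicate n True @ [False] @
     matrix_bits n (acc F Base) @ matrix_bits n (acc F Plus) @ matrix_bits n (acc F Minus))"

definition finite_frame_validity :: "'v fm \<Rightarrow> bool list set" where
  "finite_frame_validity \<phi> =
     {encode_frame F | F n. is_frame F \<and> worlds F = {..<n} \<and> validates F \<phi>}"


section \<open>The class P\<close>

text \<open>Single-tape deterministic Turing machines on a one-way infinite tape; a left move in cell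
  \<open>0\<close> leaves the head where it is. States and auxiliary tape symbols are natural numbers, of
  which each machine uses only finitely many.\<close>

datatype sym = Blank | Bit bool | Aux nat

datatype dir = Lt | Stay | Rt

fun move :: "dir \<Rightarrow> nat \<Rightarrow> nat" where
  "move Lt i = i - 1"
| "move Stay i = i"
| "move Rt i = i + 1"

record tm =
  tm_states :: "nat set"
  tm_alphabet :: "sym set"
  tm_start :: nat
  tm_accept :: nat
  tm_reject :: nat
  tm_delta :: "nat \<Rightarrow> sym \<Rightarrow> nat \<times> sym \<times> dir"

definition is_tm :: "tm \<Rightarrow> bool" where
  "is_tm M \<longleftrightarrow>
     finite (tm_states M) \<and> finite (tm_alphabet M) \<and>
     {Blank, Bit False, Bit True} \<subseteq> tm_alphabet M \<and>
     {tm_start M, tm_accept M, tm_reject M} \<subseteq> tm_states M \<and>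
     tm_accept M \<noteq> tm_reject M \<and>
     (\<forall>q\<in>tm_states M. \<forall>a\<in>tm_alphabet M. \<forall>q' b d.
        tm_delta M q a = (q', b, d) \<longrightarrow> q' \<in> tm_states M \<and> b \<in> tm_alphabet M)"

record tm_config =
  tc_state :: nat
  tc_head :: nat
  tc_tape :: "nat \<Rightarrow> sym"

definition tm_init :: "tm \<Rightarrow> bool list \<Rightarrow> tm_config" where
  "tm_init M x =
     \<lparr>tc_state = tm_start M, tc_head = 0,
      tc_tape = (\<lambda>j. if j < length x then Bit (x ! j) else Blank)\<rparr>"

definition tm_step :: "tm \<Rightarrow> tm_config \<Rightarrow> tm_config" where
  "tm_step M c =
     (if tc_state c \<in> {tm_accept M, tm_reject M} then c
      else let (q', b, d) = tm_delta M (tc_state c) (tc_tape c (tc_head c)) in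
        \<lparr>tc_state = q', tc_head = move d (tc_head c),
         tc_tape = (tc_tape c)(tc_head c := b)\<rparr>)"

definition tm_decides_in_time :: "tm \<Rightarrow> bool list set \<Rightarrow> (nat \<Rightarrow> nat) \<Rightarrow> bool" where
  "tm_decides_in_time M A T \<longleftrightarrow>
     (\<forall>x. \<exists>k\<le>T (length x).
        tc_state ((tm_step M ^^ k) (tm_init M x)) = (if x \<in> A then tm_accept M else tm_reject M))"

definition class_P :: "bool list set set" where
  "class_P = {A. \<exists>M c d. is_tm M \<and> tm_decides_in_time M A (\<lambda>n. c * n ^ d + c)}"


section \<open>Logspace many-one reductions\<close>

text \<open>Deterministic transducers with a two-way read-only input tape, finitely many one-way infinite
  work tapes and a write-only output tape, to which each step appends at most one bit. The input
  \<open>x\<close> occupies cells \<open>1, \<dots>, length x\<close>, between two end markers that the input head cannot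
  leave.\<close>

datatype input_sym = LeftEnd | InBit bool | RightEnd

definition read_input :: "bool list \<Rightarrow> nat \<Rightarrow> input_sym" where
  "read_input x i =
     (if i = 0 then LeftEnd else if i \<le> length x then InBit (x ! (i - 1)) else RightEnd)"

text \<open>The result of \<open>tr_delta\<close> is the new state, the move of the input head, for every work
  tape the symbol written and the head move, and the output, if any.\<close>

record transducer =
  tr_states :: "nat set"
  tr_alphabet :: "sym set"
  tr_tapes :: nat
  tr_start :: nat
  tr_halt :: nat
  tr_delta :: "nat \<Rightarrow> input_sym \<Rightarrow> sym list \<Rightarrow> nat \<times> dir \<times> (sym \<times> dir) list \<times> bool option"

definition is_transducer :: "transducer \<Rightarrow> bool" where
  "is_transducer M \<longleftrightarrow>
     finite (tr_states M) \<and> finite (tr_alphabet M) \<and> Blank \<in> tr_alphabet M \<and>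
     {tr_start M, tr_halt M} \<subseteq> tr_states M \<and>
     (\<forall>q\<in>tr_states M. \<forall>a ss. length ss = tr_tapes M \<longrightarrow> set ss \<subseteq> tr_alphabet M \<longrightarrow>
        (\<forall>q' d ws out. tr_delta M q a ss = (q', d, ws, out) \<longrightarrow>
           q' \<in> tr_states M \<and> length ws = tr_tapes M \<and> fst ` set ws \<subseteq> tr_alphabet M))"

record tr_config =
  rc_state :: nat
  rc_input_head :: nat
  rc_work :: "(nat \<times> (nat \<Rightarrow> sym)) list" \<comment> \<open>head position and contents of each work tape\<close>
  rc_output :: "bool list"

definition tr_init :: "transducer \<Rightarrow> tr_config" where
  "tr_init M =
     \<lparr>rc_state = tr_start M, rc_input_head = 0,
      rc_work = replicate (tr_tapes M) (0, \<lambda>_. Blank), rc_output = []\<rparr>"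

definition tr_step :: "transducer \<Rightarrow> bool list \<Rightarrow> tr_config \<Rightarrow> tr_config" where
  "tr_step M x c =
     (if rc_state c = tr_halt M then c
      else let (q', d, ws, out) =
          tr_delta M (rc_state c) (read_input x (rc_input_head c))
            (map (\<lambda>(h, \<tau>). \<tau> h) (rc_work c)) in
        \<lparr>rc_state = q',
         rc_input_head = min (length x + 1) (move d (rc_input_head c)),
         rc_work = map2 (\<lambda>(b, e) (h, \<tau>). (move e h, \<tau>(h := b))) ws (rc_work c),
         rc_output = rc_output c @ (case out of None \<Rightarrow> [] | Some b \<Rightarrow> [b])\<rparr>)"

definition tr_run :: "transducer \<Rightarrow> bool list \<Rightarrow> nat \<Rightarrow> tr_config" where
  "tr_run M x k = (tr_step M x ^^ k) (tr_init M)"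

definition tr_computes :: "transducer \<Rightarrow> (bool list \<Rightarrow> bool list) \<Rightarrow> bool" where
  "tr_computes M f \<longleftrightarrow>
     (\<forall>x. \<exists>k. rc_state (tr_run M x k) = tr_halt M \<and> rc_output (tr_run M x k) = f x)"

text \<open>Only the work tapes count towards space. The offset in \<open>log 2 (n + 2)\<close> serves to keep the
  bound positive for \<open>n \<le> 1\<close>.\<close>

definition tr_logspace :: "transducer \<Rightarrow> bool" where
  "tr_logspace M \<longleftrightarrow>
     (\<exists>c::real. \<forall>x k. \<forall>(h, \<tau>) \<in> set (rc_work (tr_run M x k)).
        real h \<le> c * log 2 (real (length x) + 2))"

definition logspace_computable :: "(bool list \<Rightarrow> bool list) \<Rightarrow> bool" where
  "logspace_computable f \<longleftrightarrow> (\<exists>M. is_transducer M \<and> tr_logspace M \<and> tr_computes M f)"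

definition logspace_reducible :: "bool list set \<Rightarrow> bool list set \<Rightarrow> bool" where
  "logspace_reducible A B \<longleftrightarrow> (\<exists>f. logspace_computable f \<and> (\<forall>x. x \<in> A \<longleftrightarrow> f x \<in> B))"

definition P_hard :: "bool list set \<Rightarrow> bool" where
  "P_hard B \<longleftrightarrow> (\<forall>A\<in>class_P. logspace_reducible A B)"

end

theory Submission
  imports Defs "HOL-Library.Countable"
begin

text \<open>A frame validates \<open>phi_h\<close> iff \<open>R\<^sup>+\<close> is a partial function and, for every world \<open>w\<close>, the Horn
  clauses \<open>\<And>R\<^sup>-(v) \<longrightarrow> R\<^sup>+(v)\<close> with \<open>v \<in> R(w)\<close> are jointly unsatisfiable, a valuation of \<open>t\<close> being an
  assignment to the worlds read as variables. The accepting run of a polynomial-time machine is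
  described by such clauses, with worlds the quadruples of numbers below \<open>N = B ^ l\<close>, where
  \<open>2 ^ l > |x| + 2\<close> and \<open>B\<close> is a large constant. In base \<open>B\<close> these numbers have \<open>l = O(log |x|)\<close>
  digits, and the relations of the frame can be decided by a finite automaton that reads the
  digits of two worlds in parallel. So a transducer that counts through all pairs of worlds on
  one tape of length \<open>l + O(1)\<close>, one position of the input at a time, writes down the frame.\<close>

section \<open>Sweeping transducers\<close>

text \<open>Validity of \<open>phi_h\<close> makes \<open>Plus\<close> functional, so a clause has
  at most one conclusion. A machine transition is therefore split into clauses for the written cell,
  the new state and each untouched cell. The last kind speaks of two positions at once, the head and
  the cell, which is why a world carries a second position. The transducer never computes the time
  bound. In base \<open>2 ^ b\<close> with \<open>l\<close> digits, N is
  \<open>(2 ^ b) ^ l = (2 ^ l) ^ b\<close>, a fixed power of a number larger than the input length.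
  A constant \<open>b\<close> chosen from the machine alone thus beats its polynomial running time,
  and the tape only needs the length \<open>l\<close>. Nothing depends on the exact
  \<open>l\<close>: every sufficiently large frame is correct. A clause depends on the input through
  a single symbol, the one at its position. The automaton can therefore run over the digits without
  the input, and its final state is combined with that symbol afterwards. The tuples are enumerated
  with this position as second most significant entry, so that the input head moves right step by
  step and is rarely rewound.\<close>

datatype 'q control = Start | Halt | Forward 'q | Backward 'q

instance control :: (countable) countable
  by countable_datatype

fun emit :: "bool option \<Rightarrow> bool list" where
  "emit None = []"
| "emit (Some b) = [b]"

text \<open>The work tape consists of a marker in cell 0 followed by a word over \<open>C\<close>. The machine
  repeatedly rewrites the word from left to right by \<open>pass\<close>, may append a cell at the end, and
  returns to the marker, where alone it looks at the input, moves the input head and writes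
  output. A decision without a next state halts.\<close>

locale sweep_machine =
  fixes Q :: "'q::countable set" and C :: "'c::countable set" and start :: 'q
    and pass :: "'q \<Rightarrow> 'c \<Rightarrow> 'q \<times> 'c"
    and extend :: "'q \<Rightarrow> 'c list"
    and decide :: "'q \<Rightarrow> input_sym \<Rightarrow> 'q option \<times> dir \<times> bool option"
  assumes finite_Q: "finite Q" and finite_C: "finite C" and start_Q: "start \<in> Q"
    and pass_closed: "q \<in> Q \<Longrightarrow> c \<in> C \<Longrightarrow> pass q c \<in> Q \<times> C"
    and extend_closed: "q \<in> Q \<Longrightarrow> extend q = [] \<or> (\<exists>c\<in>C. extend q = [c])"
    and decide_closed: "q \<in> Q \<Longrightarrow> fst (decide q a) \<in> insert None (Some ` Q)"
    and extend_length: "length (extend q) \<le> 1"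
begin

primrec sweep :: "'q \<Rightarrow> 'c list \<Rightarrow> 'q \<times> 'c list" where
  "sweep q [] = (q, [])"
| "sweep q (c # w) =
     (let (q1, c1) = pass q c; (q2, w2) = sweep q1 w in (q2, c1 # w2))"

text \<open>The length bound is strict because the forward pass ends on the blank behind the word,
  one cell further than the word reaches.\<close>

definition macro :: "bool list \<Rightarrow> nat \<Rightarrow> 'q option \<times> 'c list \<times> nat \<times> bool list
    \<Rightarrow> 'q option \<times> 'c list \<times> nat \<times> bool list \<Rightarrow> bool" where
  "macro x b c c' \<longleftrightarrow> (\<exists>q w h out q1 w1 r d o'. c = (Some q, w, h, out) \<and>
     sweep q w = (q1, w1) \<and> decide q1 (read_input x h) = (r, d, o') \<and>
     length w1 + length (extend q1) < b \<and>
     c' = (r, w1 @ extend q1, min (length x + 1) (move d h), out @ emit o'))"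

definition marker :: sym where
  "marker = Aux 0"

definition cell :: "'c \<Rightarrow> sym" where
  "cell c = Aux (Suc (to_nat c))"

text \<open>Any symbol that is not a cell ends the pass. In a simulated run this is the blank behind
  the word, and only this one cell can be written before turning back; hence \<open>extend\<close>
  yields at most one cell.\<close>

fun forward :: "'q \<Rightarrow> sym \<Rightarrow> 'q control \<times> sym \<times> dir" where
  "forward q (Aux (Suc n)) = (let (q', c) = pass q (from_nat n) in (Forward q', cell c, Rt))"
| "forward q s = (Backward q, (case extend q of [] \<Rightarrow> s | c # _ \<Rightarrow> cell c), Lt)"

fun control_delta :: "'q control \<Rightarrow> input_sym \<Rightarrow> sym \<Rightarrow> 'q control \<times> dir \<times> (sym \<times> dir) \<times> bool option" where
  "control_delta Start a s = (Forward start, Stay, (marker, Rt), None)"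
| "control_delta Halt a s = (Halt, Stay, (s, Stay), None)"
| "control_delta (Forward q) a s = (let (k, s', d) = forward q s in (k, Stay, (s', d), None))"
| "control_delta (Backward q) a s =
     (if s = marker then
        (case decide q a of
           (None, d, out) \<Rightarrow> (Halt, d, (marker, Stay), out)
         | (Some q', d, out) \<Rightarrow> (Forward q', d, (marker, Rt), out))
      else (Backward q, Stay, (s, Lt), None))"

definition machine :: transducer where
  "machine = \<lparr>tr_states = to_nat ` ({Start, Halt} \<union> Forward ` Q \<union> Backward ` Q),
     tr_alphabet = {Blank, marker} \<union> cell ` C, tr_tapes = 1,
     tr_start = to_nat (Start :: 'q control), tr_halt = to_nat (Halt :: 'q control),
     tr_delta = (\<lambda>n a ss. let (k, d, w, out) = control_delta (from_nat n) a (hd ss)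
       in (to_nat k, d, [w], out))\<rparr>"

lemma forward_closed:
  assumes "q \<in> Q" "s \<in> {Blank, marker} \<union> cell ` C" "forward q s = (k, s', d)"
  shows "k \<in> Forward ` Q \<union> Backward ` Q" "s' \<in> {Blank, marker} \<union> cell ` C"
proof -
  have "k \<in> Forward ` Q \<union> Backward ` Q \<and> s' \<in> {Blank, marker} \<union> cell ` C"
  proof (cases "s \<in> cell ` C")
    case True
    then obtain c where "c \<in> C" "s = cell c" by auto
    with assms pass_closed[of q c] show ?thesis
      by (auto simp: cell_def split: prod.splits)
  next
    case False
    with assms extend_closed[of q] show ?thesis
      by (auto simp: marker_def)
  qed
  then show "k \<in> Forward ` Q \<union> Backward ` Q" "s' \<in> {Blank, marker} \<union> cell ` C" by auto
qed

lemma control_closed: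
  assumes "k \<in> {Start, Halt} \<union> Forward ` Q \<union> Backward ` Q" "s \<in> {Blank, marker} \<union> cell ` C"
    "control_delta k a s = (k', d, w, out)"
  shows "k' \<in> {Start, Halt} \<union> Forward ` Q \<union> Backward ` Q" "fst w \<in> {Blank, marker} \<union> cell ` C"
proof -
  have "k' \<in> {Start, Halt} \<union> Forward ` Q \<union> Backward ` Q \<and> fst w \<in> {Blank, marker} \<union> cell ` C"
  proof (cases k)
    case (Forward q)
    obtain k1 s1 d1 where f: "forward q s = (k1, s1, d1)" by (metis prod_cases3)
    show ?thesis using forward_closed[OF _ assms(2) f] assms Forward f by auto
  next
    case (Backward q)
    then have "q \<in> Q" using assms by auto
    from decide_closed[OF this, of a] show ?thesis using assms Backward start_Q
      by (auto split: if_splits prod.splits option.splits)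
  qed (use assms start_Q in auto)
  then show "k' \<in> {Start, Halt} \<union> Forward ` Q \<union> Backward ` Q" "fst w \<in> {Blank, marker} \<union> cell ` C"
    by auto
qed

lemma is_transducer_machine: "is_transducer machine"
proof -
  let ?S = "{Start, Halt} \<union> Forward ` Q \<union> Backward ` Q"
  let ?A = "{Blank, marker} \<union> cell ` C"
  have "q' \<in> to_nat ` ?S \<and> length ws = 1 \<and> fst ` set ws \<subseteq> ?A"
    if step: "q \<in> to_nat ` ?S" "length ss = 1" "set ss \<subseteq> ?A"
      "tr_delta machine q a ss = (q', d, ws, out)" for q a ss q' d ws out
  proof -
    from step(1) obtain k where k: "k \<in> ?S" "q = to_nat k" by (elim imageE)
    obtain s where s: "ss = [s]" using step(2) by (auto simp: length_Suc_conv)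
    obtain k1 d1 w1 o1 where e: "control_delta k a s = (k1, d1, w1, o1)" by (metis prod_cases4)
    have "s \<in> ?A" using step(3) s by auto
    from control_closed[OF k(1) this e] show ?thesis
      using step(4) k s e by (auto simp: machine_def)
  qed
  then show ?thesis
    unfolding is_transducer_def using finite_Q finite_C
    by (simp add: machine_def)
qed

section \<open>Simulation of sweeps step by step, with the space bound\<close>

definition tape :: "'c list \<Rightarrow> nat \<Rightarrow> sym" where
  "tape w j = (if j = 0 then marker else if j \<le> length w then cell (w ! (j - 1)) else Blank)"

definition conf :: "'q control \<Rightarrow> nat \<Rightarrow> 'c list \<Rightarrow> nat \<Rightarrow> bool list \<Rightarrow> tr_config" where
  "conf k i w h out = \<lparr>rc_state = to_nat k, rc_input_head = i, rc_work = [(h, tape w)], rc_output = out\<rparr>"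

text \<open>A step is bundled with the space used before it, so that a single reflexive transitive
  closure yields both halting and the space bound.\<close>

definition small :: "bool list \<Rightarrow> nat \<Rightarrow> tr_config \<Rightarrow> tr_config \<Rightarrow> bool" where
  "small x b c c' \<longleftrightarrow> c' = tr_step machine x c \<and> (\<forall>(h, \<tau>)\<in>set (rc_work c). h \<le> b)"

lemma small_conf:
  assumes "control_delta k (read_input x i) (tape w h) = (k', d, (s, e), out')" "k \<noteq> Halt" "h \<le> b"
    and "(tape w)(h := s) = tape w'"
    and "i' = min (length x + 1) (move d i)" "h' = move e h"
  shows "small x b (conf k i w h out) (conf k' i' w' h' (out @ emit out'))"
  using assms
  by (cases out') (auto simp: small_def conf_def tr_step_def machine_def)

lemma small_forward:
  assumes "sweep q w = (q', w')" "length u + length w < b" "i \<le> length x + 1"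
  shows "(small x b)\<^sup>*\<^sup>* (conf (Forward q) i (u @ w) (length u + 1) out)
           (conf (Forward q') i (u @ w') (length u + length w + 1) out)"
  using assms
proof (induction w arbitrary: q u w')
  case (Cons c w)
  obtain q1 c1 where p: "pass q c = (q1, c1)" by force
  obtain w2 where s: "sweep q1 w = (q', w2)" and w': "w' = c1 # w2"
    using Cons.prems p by (auto split: prod.splits)
  have t: "tape (u @ c # w) (length u + 1) = cell c" by (simp add: tape_def)
  have u: "(tape (u @ c # w))(length u + 1 := cell c1) = tape (u @ c1 # w)"
    by (auto simp: tape_def fun_eq_iff nth_append nth_Cons')
  have "small x b (conf (Forward q) i (u @ c # w) (length u + 1) out)
      (conf (Forward q1) i (u @ c1 # w) (length u + 1 + 1) (out @ emit None))"
    by (rule small_conf) (use Cons.prems p t u in \<open>auto simp: cell_def\<close>)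
  moreover have "(small x b)\<^sup>*\<^sup>* (conf (Forward q1) i ((u @ [c1]) @ w) (length (u @ [c1]) + 1) out)
      (conf (Forward q') i ((u @ [c1]) @ w2) (length (u @ [c1]) + length w + 1) out)"
    using Cons.IH[OF s, of "u @ [c1]"] Cons.prems by simp
  ultimately show ?case by (simp add: w' converse_rtranclp_into_rtranclp)
qed simp

lemma small_backward:
  assumes "h \<le> length w" "length w \<le> b" "i \<le> length x + 1"
  shows "(small x b)\<^sup>*\<^sup>* (conf (Backward q) i w h out) (conf (Backward q) i w 0 out)"
  using assms(1)
proof (induction h)
  case (Suc h)
  have "small x b (conf (Backward q) i w (Suc h) out) (conf (Backward q) i w h (out @ emit None))"
    by (rule small_conf)
      (use Suc.prems assms in \<open>auto simp: tape_def marker_def cell_def fun_eq_iff\<close>)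
  then show ?case using Suc by (simp add: converse_rtranclp_into_rtranclp)
qed simp

fun macro_conf :: "'q option \<times> 'c list \<times> nat \<times> bool list \<Rightarrow> tr_config" where
  "macro_conf (None, w, i, out) = conf Halt i w 0 out"
| "macro_conf (Some q, w, i, out) = conf (Forward q) i w 1 out"

lemma macro_small:
  assumes "macro x b c c'" "fst (snd (snd c)) \<le> length x + 1"
  shows "(small x b)\<^sup>*\<^sup>* (macro_conf c) (macro_conf c') \<and> fst (snd (snd c')) \<le> length x + 1"
proof -
  obtain q w i out q1 w1 r d o' where c: "c = (Some q, w, i, out)"
    and sw: "sweep q w = (q1, w1)" and dec: "decide q1 (read_input x i) = (r, d, o')"
    and len: "length w1 + length (extend q1) < b"
    and c': "c' = (r, w1 @ extend q1, min (length x + 1) (move d i), out @ emit o')"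
    using assms unfolding macro_def by blast
  let ?w = "w1 @ extend q1"
  have i: "i \<le> length x + 1" using assms(2) c by simp
  have lw: "length w1 = length w" using sw
    by (induction w arbitrary: q q1 w1) (auto split: prod.splits)
  have 1: "(small x b)\<^sup>*\<^sup>* (macro_conf c) (conf (Forward q1) i w1 (length w1 + 1) out)"
    using small_forward[OF sw, of "[]" b i x out] i len lw c by simp
  have t: "tape w1 (length w1 + 1) = Blank" by (simp add: tape_def)
  have u: "(tape w1)(length w1 + 1 := (case extend q1 of [] \<Rightarrow> Blank | c # _ \<Rightarrow> cell c)) = tape ?w"
    using extend_length[of q1]
    by (cases "extend q1") (auto simp: tape_def fun_eq_iff nth_append)
  have 2: "small x b (conf (Forward q1) i w1 (length w1 + 1) out)
      (conf (Backward q1) i ?w (length w1) (out @ emit None))"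
    by (rule small_conf) (use len t u i in auto)
  have 3: "(small x b)\<^sup>*\<^sup>* (conf (Backward q1) i ?w (length w1) out) (conf (Backward q1) i ?w 0 out)"
    by (rule small_backward) (use len i in auto)
  have m: "tape ?w 0 = marker" "(tape ?w)(0 := marker) = tape ?w"
    by (auto simp: tape_def)
  have 4: "small x b (conf (Backward q1) i ?w 0 out) (macro_conf c')"
  proof (cases r)
    case None
    show ?thesis unfolding None c' macro_conf.simps
      by (rule small_conf) (use None dec m in auto)
  next
    case (Some q')
    show ?thesis unfolding Some c' macro_conf.simps
      by (rule small_conf) (use Some dec m in auto)
  qed
  have "(small x b)\<^sup>*\<^sup>* (macro_conf c) (macro_conf c')"
    using rtranclp_trans[OF 1 converse_rtranclp_into_rtranclp[OF _ rtranclp.rtrancl_into_rtrancl[OF 3 4]]] 2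
    by simp
  then show ?thesis by (simp add: c')
qed

lemma macros_small:
  assumes "(macro x b)\<^sup>*\<^sup>* c c'" "fst (snd (snd c)) \<le> length x + 1"
  shows "(small x b)\<^sup>*\<^sup>* (macro_conf c) (macro_conf c') \<and> fst (snd (snd c')) \<le> length x + 1"
  using assms
proof (induction rule: rtranclp_induct)
  case (step y z)
  then show ?case using macro_small[of x b y z] by (meson rtranclp_trans)
qed simp

text \<open>Configurations on the chain are bounded by \<open>small\<close>, and all later ones
  equal the fixed point \<open>c'\<close>. So the bound holds at every time, as
  \<open>tr_logspace\<close> demands.\<close>

lemma small_funpow:
  assumes "(small x b)\<^sup>*\<^sup>* c c'" "tr_step machine x c' = c'" "\<forall>(h, \<tau>)\<in>set (rc_work c'). h \<le> b"
  shows "(\<exists>k. (tr_step machine x ^^ k) c = c') \<and>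
    (\<forall>k. \<forall>(h, \<tau>)\<in>set (rc_work ((tr_step machine x ^^ k) c)). h \<le> b)"
  using assms(1)
proof (induction rule: converse_rtranclp_induct)
  case base
  have "(tr_step machine x ^^ k) c' = c'" for k
    by (induction k) (use assms(2) in auto)
  then show ?case using assms(3) by auto
next
  case (step y z)
  then have z: "z = tr_step machine x y" "\<forall>(h, \<tau>)\<in>set (rc_work y). h \<le> b"
    by (auto simp: small_def)
  have s: "(tr_step machine x ^^ Suc k) y = (tr_step machine x ^^ k) z" for k
    by (simp add: z(1) funpow_swap1)
  have "\<forall>(h, \<tau>)\<in>set (rc_work ((tr_step machine x ^^ k) y)). h \<le> b" for k
    by (cases k) (use z(2) step.IH s in \<open>auto simp del: funpow.simps(2)\<close>)
  then show ?case using step.IH s by metis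
qed

lemma logspace_machine:
  assumes run: "\<And>x. \<exists>w i. (macro x (b x))\<^sup>*\<^sup>* (Some start, [], 0, []) (None, w, i, f x)"
    and log: "\<And>x. real (b x) \<le> e * log 2 (real (length x) + 2)" and pos: "\<And>x. 0 < b x"
  shows "logspace_computable f"
proof -
  have main: "(\<exists>k. rc_state (tr_run machine x k) = tr_halt machine \<and> rc_output (tr_run machine x k) = f x) \<and>
      (\<forall>k. \<forall>(h, \<tau>)\<in>set (rc_work (tr_run machine x k)). h \<le> b x)" for x
  proof -
    obtain w i where "(macro x (b x))\<^sup>*\<^sup>* (Some start, [], 0, []) (None, w, i, f x)"
      using run by blast
    from macros_small[OF this]
    have r: "(small x (b x))\<^sup>*\<^sup>* (conf (Forward start) 0 [] 1 []) (conf Halt i w 0 (f x))" by simp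
    have "small x (b x) (tr_init machine) (conf (Forward start) 0 [] 1 [])"
      using pos[of x]
      by (auto simp: small_def conf_def tr_step_def machine_def tr_init_def tape_def fun_eq_iff)
    then have r': "(small x (b x))\<^sup>*\<^sup>* (tr_init machine) (conf Halt i w 0 (f x))"
      using r by (rule converse_rtranclp_into_rtranclp)
    have "tr_step machine x (conf Halt i w 0 (f x)) = conf Halt i w 0 (f x)"
      by (simp add: tr_step_def machine_def conf_def)
    from small_funpow[OF r' this] obtain k where
      "(tr_step machine x ^^ k) (tr_init machine) = conf Halt i w 0 (f x)"
      "\<forall>k. \<forall>(h, \<tau>)\<in>set (rc_work ((tr_step machine x ^^ k) (tr_init machine))). h \<le> b x"
      by (auto simp: conf_def)
    then show ?thesis unfolding tr_run_def by (auto simp: conf_def machine_def intro!: exI[of _ k])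
  qed
  have "real h \<le> e * log 2 (real (length x) + 2)"
    if "(h, \<tau>) \<in> set (rc_work (tr_run machine x k))" for x k h \<tau>
  proof -
    have "real h \<le> real (b x)" using main[of x] that by fastforce
    then show ?thesis using log[of x] by linarith
  qed
  then have "tr_logspace machine" unfolding tr_logspace_def by (intro exI[of _ e]) auto
  moreover have "tr_computes machine f" unfolding tr_computes_def using main by blast
  ultimately show ?thesis unfolding logspace_computable_def using is_transducer_machine by blast
qed

end

section \<open>Regular functions of tuples of numbers\<close>

definition columns :: "nat \<Rightarrow> nat \<Rightarrow> nat list set" where
  "columns K b = {c. length c = K \<and> set c \<subseteq> {..<b}}"

primrec track :: "nat \<Rightarrow> nat \<Rightarrow> nat list list \<Rightarrow> nat" where
  "track b k [] = 0"
| "track b k (c # w) = c ! k + b * track b k w"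

definition tracks :: "nat \<Rightarrow> nat \<Rightarrow> nat list list \<Rightarrow> nat list" where
  "tracks b K w = map (\<lambda>k. track b k w) [0..<K]"

lemma finite_columns: "finite (columns K b)"
proof -
  have "columns K b = {c. set c \<subseteq> {..<b} \<and> length c = K}" by (auto simp: columns_def)
  then show ?thesis using finite_lists_length_eq[of "{..<b}" K] by simp
qed

lemma columns_nth: "c \<in> columns K b \<Longrightarrow> k < K \<Longrightarrow> c ! k < b"
  by (auto simp: columns_def subset_iff)

lemma nth_tracks [simp]: "k < K \<Longrightarrow> tracks b K w ! k = track b k w"
  by (simp add: tracks_def)

text \<open>A finite automaton with output, reading all tracks in parallel from the least
  significant digit. The value may depend on the numbers only, not on how many zero columns pad
  them. States are natural numbers because a definition cannot quantify over a state type.\<close>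

definition regular :: "nat \<Rightarrow> nat \<Rightarrow> (nat list \<Rightarrow> 'a) \<Rightarrow> bool" where
  "regular b K f \<longleftrightarrow> (\<exists>(S :: nat set) \<delta> q g. finite S \<and> q \<in> S \<and>
     (\<forall>p\<in>S. \<forall>c\<in>columns K b. \<delta> p c \<in> S) \<and>
     (\<forall>w\<in>lists (columns K b). f (tracks b K w) = g (foldl \<delta> q w)))"

text \<open>The family \<open>F\<close> plays the role of the Brzozowski derivatives of \<open>f\<close>.\<close>

lemma regularI:
  fixes S :: "nat set"
  assumes "finite S" "q \<in> S" "\<And>p c. p \<in> S \<Longrightarrow> c \<in> columns K b \<Longrightarrow> \<delta> p c \<in> S"
    and derivative: "\<And>p c w. p \<in> S \<Longrightarrow> c \<in> columns K b \<Longrightarrow> w \<in> lists (columns K b) \<Longrightarrow>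
      F p (tracks b K (c # w)) = F (\<delta> p c) (tracks b K w)"
    and "\<And>v. f v = F q v"
  shows "regular b K f"
proof -
  have "F p (tracks b K w) = F (foldl \<delta> p w) (tracks b K [])"
    if "w \<in> lists (columns K b)" "p \<in> S" for w p
    using that
  proof (induction w arbitrary: p)
    case (Cons c w)
    then show ?case using derivative[of p c w] assms(3)[of p c] by simp
  qed simp
  then show ?thesis unfolding regular_def using assms
    by (intro exI[of _ S] exI[of _ \<delta>] exI[of _ q] exI[of _ "\<lambda>p. F p (tracks b K [])"]) auto
qed

lemma regular_const: "regular b K (\<lambda>_. a)"
  by (rule regularI[where S = "{0}" and q = 0 and \<delta> = "\<lambda>_ _. 0" and F = "\<lambda>_ _. a"]) auto

text \<open>Product automaton, with pairs of states coded by \<open>prod_encode\<close>. All Boolean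
  closure properties are instances.\<close>

lemma regular_apply2:
  assumes "regular b K f" "regular b K g"
  shows "regular b K (\<lambda>v. h (f v) (g v))"
proof -
  obtain S \<delta> q f' where f: "finite (S :: nat set)" "q \<in> S" "\<forall>p\<in>S. \<forall>c\<in>columns K b. \<delta> p c \<in> S"
    "\<forall>w\<in>lists (columns K b). f (tracks b K w) = f' (foldl \<delta> q w)"
    using assms(1) unfolding regular_def by blast
  obtain T \<epsilon> r g' where g: "finite (T :: nat set)" "r \<in> T" "\<forall>p\<in>T. \<forall>c\<in>columns K b. \<epsilon> p c \<in> T"
    "\<forall>w\<in>lists (columns K b). g (tracks b K w) = g' (foldl \<epsilon> r w)"
    using assms(2) unfolding regular_def by blast
  define \<theta> where "\<theta> n c = (case prod_decode n of (p, p') \<Rightarrow> prod_encode (\<delta> p c, \<epsilon> p' c))" for n c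
  have run: "foldl \<theta> (prod_encode (p, p')) w = prod_encode (foldl \<delta> p w, foldl \<epsilon> p' w)" for p p' w
    by (induction w arbitrary: p p') (simp_all add: \<theta>_def)
  show ?thesis unfolding regular_def
    using f g
    by (intro exI[of _ "prod_encode ` (S \<times> T)"] exI[of _ \<theta>] exI[of _ "prod_encode (q, r)"]
        exI[of _ "\<lambda>n. case prod_decode n of (p, p') \<Rightarrow> h (f' p) (g' p')"])
      (auto simp: run, auto simp: \<theta>_def)
qed

lemma regular_not: "regular b K P \<Longrightarrow> regular b K (\<lambda>v. \<not> P v)"
  using regular_apply2[of b K P P "\<lambda>x _. \<not> x"] by simp

lemma regular_and: "regular b K P \<Longrightarrow> regular b K P' \<Longrightarrow> regular b K (\<lambda>v. P v \<and> P' v)"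
  by (rule regular_apply2)

lemma regular_or: "regular b K P \<Longrightarrow> regular b K P' \<Longrightarrow> regular b K (\<lambda>v. P v \<or> P' v)"
  by (rule regular_apply2)

lemma regular_if:
  assumes "regular b K P" "regular b K f" "regular b K g"
  shows "regular b K (\<lambda>v. if P v then f v else g v)"
  using regular_apply2[OF assms(1) regular_apply2[OF assms(2,3), of Pair],
      of "\<lambda>x y. if x then fst y else snd y"] by (simp cong: if_cong)

lemma regular_bex:
  assumes "finite A" "\<And>a. a \<in> A \<Longrightarrow> regular b K (P a)"
  shows "regular b K (\<lambda>v. \<exists>a\<in>A. P a v)"
  using assms
proof (induction A)
  case (insert a A)
  then show ?case using regular_or[of b K "P a"] by simp
qed (simp add: regular_const)

text \<open>The automaton has to be fixed before the input symbol is seen. As there are only four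
  symbols, a function of the symbol is a quadruple of values, and four automata run side by
  side.\<close>

lemma regular_input_sym:
  assumes "\<And>a. regular b K (\<lambda>v. f v (a :: input_sym))"
  shows "regular b K f"
proof -
  define h where "h y z = (\<lambda>a. case a of LeftEnd \<Rightarrow> fst y | RightEnd \<Rightarrow> snd y
    | InBit c \<Rightarrow> if c then fst z else snd z)" for y z :: "'a \<times> 'a"
  have "regular b K (\<lambda>v. h (f v LeftEnd, f v RightEnd) (f v (InBit True), f v (InBit False)))"
    by (intro regular_apply2[where h = h] regular_apply2[where h = Pair] assms)
  moreover have "(\<lambda>v. h (f v LeftEnd, f v RightEnd) (f v (InBit True), f v (InBit False))) = f"
    by (auto simp: h_def fun_eq_iff split: input_sym.splits)
  ultimately show ?thesis by simp
qed

lemma digit_unique: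
  assumes "x < b" "y < (b::nat)"
  shows "x + b * m = y + b * n \<longleftrightarrow> x = y \<and> m = n"
proof
  assume e: "x + b * m = y + b * n"
  have "x = (x + b * m) mod b" using assms by simp
  also have "\<dots> = y" using assms e by simp
  finally show "x = y \<and> m = n" using e assms by auto
qed simp

lemma regular_eq:
  assumes "i < K" "j < K"
  shows "regular b K (\<lambda>v. v ! i = v ! j)"
proof (rule regularI[where S = "{0, 1}" and q = 1
    and \<delta> = "\<lambda>p c. if p = 1 \<and> c ! i = c ! j then 1 else 0" and F = "\<lambda>p v. p = 1 \<and> v ! i = v ! j"])
  fix p :: nat and c w assume "c \<in> columns K b"
  then have "c ! i < b" "c ! j < b" using assms columns_nth by auto
  from digit_unique[OF this] show "(p = 1 \<and> tracks b K (c # w) ! i = tracks b K (c # w) ! j) \<longleftrightarrow>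
      ((if p = 1 \<and> c ! i = c ! j then 1 else 0) = (1::nat) \<and> tracks b K w ! i = tracks b K w ! j)"
    using assms by auto
qed auto

text \<open>State \<open>Suc r\<close> means that the digits still to come must represent
  \<open>r\<close>; reading a digit replaces \<open>r\<close> by \<open>r div b\<close>. State 0 is
  failure.\<close>

lemma regular_eq_const:
  assumes "i < K"
  shows "regular b K (\<lambda>v. v ! i = n)"
proof (rule regularI[where S = "{..Suc n}" and q = "Suc n"
    and \<delta> = "\<lambda>p c. if p \<noteq> 0 \<and> c ! i = (p - 1) mod b then Suc ((p - 1) div b) else 0"
    and F = "\<lambda>p v. p = Suc (v ! i)"])
  fix p c assume "p \<in> {..Suc n}"
  then have "p - 1 \<le> n" by auto
  then show "(if p \<noteq> 0 \<and> c ! i = (p - 1) mod b then Suc ((p - 1) div b) else 0) \<in> {..Suc n}"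
    using le_trans[OF div_le_dividend[of "p - 1" b]] by auto
next
  fix p c w assume "c \<in> columns K b"
  then have "c ! i < b" using assms columns_nth by auto
  then have "m = c ! i + b * n \<longleftrightarrow> c ! i = m mod b \<and> m div b = n" for m n
    by (metis add.commute div_mult_self2 div_less add_cancel_left_left mod_less mod_mult_self2
        mult_div_mod_eq not_less_zero)
  then show "p = Suc (tracks b K (c # w) ! i) \<longleftrightarrow>
      (if p \<noteq> 0 \<and> c ! i = (p - 1) mod b then Suc ((p - 1) div b) else 0) = Suc (tracks b K w ! i)"
    using assms by (cases p) auto
qed auto

text \<open>State 2: the carry of the addition of 1 is still pending. State 1: it has been absorbed,
  and the remaining digits must agree. State 0 is failure.\<close>

lemma regular_eq_Suc:
  assumes "i < K" "j < K"
  shows "regular b K (\<lambda>v. v ! i = Suc (v ! j))"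
proof -
  define \<delta> :: "nat \<Rightarrow> nat list \<Rightarrow> nat" where "\<delta> p c = (if p = 1 then if c ! i = c ! j then 1 else 0
    else if p = 2 then if Suc (c ! j) < b then if c ! i = Suc (c ! j) then 1 else 0
      else if c ! i = 0 then 2 else 0 else 0)" for p c
  define F where "F p v = (if p = 1 then v ! i = v ! j else p = 2 \<and> v ! i = Suc (v ! j))"
    for p :: nat and v :: "nat list"
  show ?thesis
  proof (rule regularI[where S = "{0, 1, 2}" and q = 2 and \<delta> = \<delta> and F = F])
    fix p c w assume "c \<in> columns K b" "p \<in> {0, 1, 2::nat}"
    then have lt: "c ! i < b" "c ! j < b" using assms columns_nth by auto
    have carry: "c ! i + b * m = Suc (c ! j + b * n) \<longleftrightarrow> c ! i = 0 \<and> m = Suc n" if "\<not> Suc (c ! j) < b" for m n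
    proof -
      have le: "b = Suc (c ! j)" using that lt by simp
      then have "Suc (c ! j + b * n) = 0 + b * Suc n" by simp
      then show ?thesis using digit_unique[of "c ! i" b 0 m "Suc n"] lt by (simp only:)
    qed
    have no_carry: "c ! i + b * m = Suc (c ! j + b * n) \<longleftrightarrow> c ! i = Suc (c ! j) \<and> m = n" if "Suc (c ! j) < b" for m n
      using digit_unique[of "c ! i" b "Suc (c ! j)" m n] lt that by simp
    show "F p (tracks b K (c # w)) = F (\<delta> p c) (tracks b K w)"
      using assms digit_unique[OF lt] carry no_carry by (auto simp: F_def \<delta>_def)
  qed (auto simp: F_def \<delta>_def)
qed

section \<open>Enumerating all tuples of numbers\<close>

text \<open>The base is a parameter since the input is counted in base 2 but the tuples in base
  \<open>B\<close>. Testing \<open>b \<le> Suc (c ! k)\<close> instead of equality keeps the result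
  among the columns over \<open>B\<close> even if the digit is not below \<open>b\<close>.\<close>

definition bump :: "nat \<Rightarrow> nat \<Rightarrow> bool \<Rightarrow> nat list \<Rightarrow> bool \<times> nat list" where
  "bump b k carry c =
     (if carry then if b \<le> Suc (c ! k) then (True, c[k := 0]) else (False, c[k := Suc (c ! k)])
      else (False, c))"

primrec bumps :: "nat \<Rightarrow> nat \<Rightarrow> bool \<Rightarrow> nat list list \<Rightarrow> bool \<times> nat list list" where
  "bumps b k carry [] = (carry, [])"
| "bumps b k carry (c # w) =
     (let (carry1, c1) = bump b k carry c; (carry2, w2) = bumps b k carry1 w in (carry2, c1 # w2))"

lemma columns_update:
  assumes "c \<in> columns K b" "n < b"
  shows "c[k := n] \<in> columns K b"
  using assms set_update_subset_insert[of c k n] by (auto simp: columns_def)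

lemma bump_columns:
  assumes "c \<in> columns K B" "b \<le> B" "0 < B"
  shows "snd (bump b k carry c) \<in> columns K B"
  using assms columns_update[of c K B] by (auto simp: bump_def)

lemma bumps_length: "length (snd (bumps b k carry w)) = length w"
  by (induction w arbitrary: carry) (auto split: prod.splits, metis snd_conv)

lemma bumps_columns:
  assumes "w \<in> lists (columns K B)" "b \<le> B" "0 < B"
  shows "snd (bumps b k carry w) \<in> lists (columns K B)"
  using assms(1)
proof (induction w arbitrary: carry)
  case (Cons c w)
  then show ?case using bump_columns[OF _ assms(2,3), of c K k carry]
    by (auto split: prod.splits) (metis snd_conv in_lists_conv_set)
qed simp

lemma bumps_digits:
  assumes "\<forall>c\<in>set w. c ! k < b \<and> k < length c"
  shows "\<forall>c\<in>set (snd (bumps b k carry w)). c ! k < b \<and> k < length c"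
  using assms
proof (induction w arbitrary: carry)
  case (Cons c w)
  have "snd (bump b k carry c) ! k < b \<and> k < length (snd (bump b k carry c))"
    using Cons.prems by (auto simp: bump_def)
  then show ?case using Cons by (auto split: prod.splits) (metis snd_conv)+
qed simp

lemma bumps_track:
  assumes "\<forall>c\<in>set w. c ! k < b \<and> k < length c" "bumps b k carry w = (carry', w')"
  shows "track b k w' + b ^ length w * of_bool carry' = track b k w + of_bool carry"
  using assms
proof (induction w arbitrary: carry w')
  case (Cons c w)
  obtain carry1 c1 where b: "bump b k carry c = (carry1, c1)" by force
  obtain w2 where w: "bumps b k carry1 w = (carry', w2)" and w': "w' = c1 # w2"
    using Cons.prems b by (auto split: prod.splits)
  have "track b k w2 + b ^ length w * of_bool carry' = track b k w + of_bool carry1"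
    using Cons w by simp
  then have "b * (track b k w2 + b ^ length w * of_bool carry') = b * (track b k w + of_bool carry1)"
    by simp
  moreover have "c1 ! k + b * of_bool carry1 = c ! k + of_bool carry"
    using b Cons.prems by (auto simp: bump_def split: if_splits)
  ultimately show ?case unfolding w' by (simp add: algebra_simps)
qed simp

lemma bumps_track_other:
  assumes "j \<noteq> k" shows "track b' j (snd (bumps b k carry w)) = track b' j w"
proof (induction w arbitrary: carry)
  case (Cons c w)
  have "snd (bump b k carry c) ! j = c ! j" using assms by (auto simp: bump_def)
  then show ?case using Cons by (auto split: prod.splits) (metis snd_conv)
qed simp

section \<open>Numbers below a power and their digits\<close>

lemma track_append: "track b k (w @ w') = track b k w + b ^ length w * track b k w'"
  by (induction w) (auto simp: algebra_simps)

lemma track_less: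
  assumes "\<forall>c\<in>set w. c ! k < b" shows "track b k w < b ^ length w"
  using assms
proof (induction w)
  case (Cons c w)
  then have "Suc (track b k w) \<le> b ^ length w" by auto
  then have "b * Suc (track b k w) \<le> b * b ^ length w" by (rule mult_le_mono2)
  then show ?case using Cons.prems by simp
qed simp

lemma horner_less:
  fixes v :: "nat \<Rightarrow> nat"
  assumes "\<And>k. k < K \<Longrightarrow> v k < n"
  shows "(\<Sum>k<K. v k * n ^ k) < n ^ K"
  using assms
proof (induction K)
  case (Suc K)
  then have "(\<Sum>k<K. v k * n ^ k) < n ^ K" and "Suc (v K) \<le> n" by (auto simp: Suc_le_eq)
  from this(1) mult_le_mono1[OF this(2), of "n ^ K"] show ?case by simp
qed simp

lemma horner_digit:
  fixes v :: "nat \<Rightarrow> nat"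
  assumes "\<And>k. k < K \<Longrightarrow> v k < n" "j < K"
  shows "(\<Sum>k<K. v k * n ^ k) div n ^ j mod n = v j"
  using assms
proof (induction j arbitrary: v K)
  case 0
  then obtain K' where K: "K = Suc K'" by (cases K) auto
  have "(\<Sum>k<K. v k * n ^ k) = v 0 + n * (\<Sum>k<K'. v (Suc k) * n ^ k)"
    unfolding K sum.lessThan_Suc_shift by (simp add: sum_distrib_left algebra_simps)
  then show ?case using 0 by simp
next
  case (Suc j)
  then obtain K' where K: "K = Suc K'" by (cases K) auto
  have "(\<Sum>k<K. v k * n ^ k) = v 0 + n * (\<Sum>k<K'. v (Suc k) * n ^ k)"
    unfolding K sum.lessThan_Suc_shift by (simp add: sum_distrib_left algebra_simps)
  moreover have "v 0 < n" using Suc.prems K by auto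
  ultimately have "(\<Sum>k<K. v k * n ^ k) div n = (\<Sum>k<K'. v (Suc k) * n ^ k)" by simp
  then have "(\<Sum>k<K. v k * n ^ k) div n ^ Suc j mod n = (\<Sum>k<K'. v (Suc k) * n ^ k) div n ^ j mod n"
    by (simp add: div_mult2_eq)
  then show ?case using Suc.IH[of K' "\<lambda>k. v (Suc k)"] Suc.prems K by simp
qed

text \<open>Used with \<open>n = B ^ l\<close>: one digit in base \<open>n\<close> is the content of
  a whole track of \<open>l\<close> digits in base \<open>B\<close>.\<close>

definition digits :: "nat \<Rightarrow> nat \<Rightarrow> nat \<Rightarrow> nat list" where
  "digits n K m = map (\<lambda>k. m div n ^ k mod n) [0..<K]"

lemma nth_digits [simp]: "k < K \<Longrightarrow> digits n K m ! k = m div n ^ k mod n"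
  by (simp add: digits_def)

section \<open>The odometer and its run\<close>

datatype phase = Count bool | Rewind | Eval nat | Inc nat bool

instance phase :: countable
  by countable_datatype

text \<open>A word over \<open>columns K B\<close> holds \<open>K\<close> numbers in base \<open>B\<close>, least significant digit first.
  \<open>Count\<close> fixes its length by counting the input cells in binary on track 0, which \<open>Rewind\<close> clears
  afterwards. Then \<open>Eval\<close> and \<open>Inc\<close> alternate, \<open>Inc k\<close> passing the carry from track to track. The
  input head follows track \<open>K - 2\<close> and is rewound whenever track \<open>K - 1\<close> grows; by then track 0
  is zero, so clearing it again does no harm.\<close>

locale odometer =
  fixes B K :: nat and S :: "nat set" and \<delta> :: "nat \<Rightarrow> nat list \<Rightarrow> nat" and q\<^sub>0 :: nat
    and result :: "nat \<Rightarrow> input_sym \<Rightarrow> bool option"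
  assumes B: "2 \<le> B" and K: "2 \<le> K" and finite_S: "finite S" and initial: "q\<^sub>0 \<in> S"
    and closed: "\<And>p c. p \<in> S \<Longrightarrow> c \<in> columns K B \<Longrightarrow> \<delta> p c \<in> S"
begin

fun turn :: "phase \<Rightarrow> nat list \<Rightarrow> phase \<times> nat list" where
  "turn (Count carry) c = map_prod Count id (bump 2 0 carry c)"
| "turn Rewind c = (Rewind, c[0 := 0])"
| "turn (Eval q) c = (Eval (\<delta> q c), c)"
| "turn (Inc k carry) c = map_prod (Inc k) id (bump B k carry c)"

fun lengthen :: "phase \<Rightarrow> nat list list" where
  "lengthen (Count True) = [(replicate K 0)[0 := 1]]"
| "lengthen _ = []"

text \<open>The pass of \<open>Count\<close> has already added 1 when the input symbol is examined,
  so both end markers are counted and the total is \<open>length x + 2\<close>. The run ends when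
  the increment overflows on the last track.\<close>

fun choose_next :: "phase \<Rightarrow> input_sym \<Rightarrow> phase option \<times> dir \<times> bool option" where
  "choose_next (Count _) a =
     (if a = RightEnd then (Some Rewind, Stay, None) else (Some (Count True), Rt, None))"
| "choose_next Rewind a =
     (if a = LeftEnd then (Some (Eval q\<^sub>0), Rt, None) else (Some Rewind, Lt, None))"
| "choose_next (Eval q) a = (Some (Inc 0 True), Stay, result q a)"
| "choose_next (Inc k True) a =
     (if Suc k < K then Some (Inc (Suc k) True) else None, Stay, None)"
| "choose_next (Inc k False) a =
     (if Suc k = K then (Some Rewind, Stay, None)
      else (Some (Eval q\<^sub>0), if Suc (Suc k) = K then Rt else Stay, None))"

definition phases :: "phase set" where
  "phases = range Count \<union> {Rewind} \<union> Eval ` S \<union> (\<lambda>(k, carry). Inc k carry) ` ({..<K} \<times> UNIV)"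

sublocale sweep_machine phases "columns K B" "Count True" turn lengthen choose_next
proof
  show "finite phases" unfolding phases_def using finite_S by (auto simp: finite_image_iff)
  show "finite (columns K B)" by (rule finite_columns)
  show "Count True \<in> phases" by (simp add: phases_def)
  show "turn q c \<in> phases \<times> columns K B" if "q \<in> phases" "c \<in> columns K B" for q c
    using that B closed columns_update[of c K B 0 0] bump_columns[of c K B 2 0] bump_columns[of c K B B]
    by (cases q) (auto simp: phases_def mem_Times_iff)
  have "replicate K 0 \<in> columns K B" using B by (auto simp: columns_def)
  from columns_update[OF this, of 1 0]
  show "lengthen q = [] \<or> (\<exists>c\<in>columns K B. lengthen q = [c])" for q
    using B by (cases q rule: lengthen.cases) auto
  show "fst (choose_next q a) \<in> insert None (Some ` phases)" if "q \<in> phases" for q a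
    using that initial K by (cases "(q, a)" rule: choose_next.cases) (auto simp: phases_def image_iff)
  show "length (lengthen q) \<le> 1" for q
    by (cases q rule: lengthen.cases) auto
qed

lemma macroI:
  assumes "sweep q w = (q1, w1)" "choose_next q1 (read_input x i) = (r, d, o')"
    "length w1 + length (lengthen q1) < b" "w2 = w1 @ lengthen q1"
    "i' = min (length x + 1) (move d i)" "out' = out @ emit o'"
  shows "macro x b (Some q, w, i, out) (r, w2, i', out')"
  using assms unfolding macro_def by blast

lemma sweep_Count: "sweep (Count carry) w = map_prod Count id (bumps 2 0 carry w)"
  by (induction w arbitrary: carry) (auto split: prod.splits)

lemma sweep_Inc: "sweep (Inc k carry) w = map_prod (Inc k) id (bumps B k carry w)"
  by (induction w arbitrary: carry) (auto split: prod.splits)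

lemma sweep_Eval: "sweep (Eval q) w = (Eval (foldl \<delta> q w), w)"
  by (induction w arbitrary: q) auto

lemma sweep_Rewind: "sweep Rewind w = (Rewind, map (\<lambda>c. c[0 := 0]) w)"
  by (induction w) auto

lemma read_input_RightEnd: "i \<le> length x + 1 \<Longrightarrow> read_input x i = RightEnd \<longleftrightarrow> i = length x + 1"
  by (auto simp: read_input_def)

lemma read_input_LeftEnd: "read_input x i = LeftEnd \<longleftrightarrow> i = 0"
  by (auto simp: read_input_def)

text \<open>The invariant \<open>2 ^ length w \<le> 2 * i + 1\<close> says that the binary count has
  no leading zero, the \<open>+ 1\<close> covering the empty word for \<open>i = 0\<close>; this
  keeps the tape logarithmic. Conversely \<open>length x + 2\<close> fits into the final word, which
  gives the strict lower bound on \<open>2 ^ length w'\<close>.\<close>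

lemma count:
  assumes "i \<le> length x + 1" "w \<in> lists (columns K B)" "\<forall>c\<in>set w. c ! 0 < 2"
    "track 2 0 w = i" "2 ^ length w \<le> 2 * i + 1"
    "\<forall>j. 0 < j \<longrightarrow> j < K \<longrightarrow> track B j w = 0"
    and bound: "\<And>l. 2 ^ l \<le> 4 * (length x + 2) \<Longrightarrow> l < b"
  shows "\<exists>w'. (macro x b)\<^sup>*\<^sup>* (Some (Count True), w, i, []) (Some Rewind, w', length x + 1, []) \<and>
    w' \<in> lists (columns K B) \<and> length x + 2 < 2 ^ length w' \<and> length w' < b \<and>
    (\<forall>j. 0 < j \<longrightarrow> j < K \<longrightarrow> track B j w' = 0)"
  using assms(1-6)
proof (induction "length x + 1 - i" arbitrary: i w rule: less_induct)
  case (less)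
  let ?unit = "(replicate K 0)[0 := Suc 0]"
  have unit: "?unit \<in> columns K B" "?unit ! 0 = 1" "\<And>j. 0 < j \<Longrightarrow> j < K \<Longrightarrow> ?unit ! j = 0"
    using B K columns_update[of "replicate K 0" K B 1 0] by (auto simp: columns_def)
  obtain carry w1 where bs: "bumps 2 0 True w = (carry, w1)" by force
  have dig: "\<forall>c\<in>set w. c ! 0 < 2 \<and> 0 < length c"
    using less.prems K by (auto simp: columns_def)
  have t1: "track 2 0 w1 + 2 ^ length w * of_bool carry = Suc i"
    using bumps_track[OF dig bs] less.prems by simp
  have len1: "length w1 = length w" using bumps_length[of 2 0 True w] bs by simp
  have col1: "w1 \<in> lists (columns K B)"
    using bumps_columns[of w K B 2 0 True] less.prems B bs by simp
  have dig1: "\<forall>c\<in>set w1. c ! 0 < 2" using bumps_digits[OF dig, of True] bs by simp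
  have oth1: "\<forall>j. 0 < j \<longrightarrow> j < K \<longrightarrow> track B j w1 = 0"
    using bumps_track_other[of _ 0 B 2 True w] bs less.prems by auto
  let ?w2 = "w1 @ lengthen (Count carry)"
  have i: "i < 2 ^ length w" using track_less[of w 0 2] less.prems by auto
  have col2: "?w2 \<in> lists (columns K B)" using col1 unit by (cases carry) auto
  have dig2: "\<forall>c\<in>set ?w2. c ! 0 < 2" using dig1 unit by (cases carry) auto
  have oth2: "\<forall>j. 0 < j \<longrightarrow> j < K \<longrightarrow> track B j ?w2 = 0"
    using oth1 unit by (cases carry) (auto simp: track_append)
  have t2: "track 2 0 ?w2 = Suc i" and len2: "2 ^ length ?w2 \<le> 2 * Suc i + 1"
    using t1 unit len1 i less.prems by (cases carry; auto simp: track_append)+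
  have "2 ^ length ?w2 \<le> 4 * (length x + 2)" 
    by (rule le_trans[OF len2]) (use less.prems(1) in simp)
  then have lb: "length ?w2 < b" by (rule bound)
  have sw: "sweep (Count True) w = (Count carry, w1)" using bs by (simp add: sweep_Count)
  show ?case
  proof (cases "i = length x + 1")
    case True
    have "macro x b (Some (Count True), w, i, []) (Some Rewind, ?w2, length x + 1, [])"
      by (rule macroI[OF sw, where d = Stay and o' = None])
        (use True lb read_input_RightEnd[of i x] in auto)
    moreover have "length x + 2 < 2 ^ length ?w2"
      using track_less[OF dig2] t2 True by simp
    ultimately show ?thesis using col2 lb oth2 by blast
  next
    case False
    have "macro x b (Some (Count True), w, i, []) (Some (Count True), ?w2, Suc i, [])"
      by (rule macroI[OF sw, where d = Rt and o' = None])
        (use False lb read_input_RightEnd[of i x] less.prems in auto)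
    moreover have "\<exists>w'. (macro x b)\<^sup>*\<^sup>* (Some (Count True), ?w2, Suc i, []) (Some Rewind, w', length x + 1, []) \<and>
      w' \<in> lists (columns K B) \<and> length x + 2 < 2 ^ length w' \<and> length w' < b \<and>
      (\<forall>j. 0 < j \<longrightarrow> j < K \<longrightarrow> track B j w' = 0)"
      by (rule less.hyps[OF _ _ col2 dig2 t2 len2 oth2]) (use False less.prems in auto)
    ultimately show ?thesis by (meson converse_rtranclp_into_rtranclp)
  qed
qed

lemma rewind:
  assumes "i \<le> length x + 1" "length w < b"
  shows "(macro x b)\<^sup>*\<^sup>* (Some Rewind, w, i, out) (Some (Eval q\<^sub>0), map (\<lambda>c. c[0 := 0]) w, 1, out)"
  using assms
proof (induction i arbitrary: w)
  case 0
  have "macro x b (Some Rewind, w, 0, out) (Some (Eval q\<^sub>0), map (\<lambda>c. c[0 := 0]) w, 1, out)"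
    by (rule macroI[OF sweep_Rewind, where d = Rt and o' = None])
      (use 0 in \<open>auto simp: read_input_LeftEnd\<close>)
  then show ?case by blast
next
  case (Suc i)
  have "macro x b (Some Rewind, w, Suc i, out) (Some Rewind, map (\<lambda>c. c[0 := 0]) w, i, out)"
    by (rule macroI[OF sweep_Rewind, where d = Lt and o' = None])
      (use Suc.prems in \<open>auto simp: read_input_LeftEnd\<close>)
  moreover have "(macro x b)\<^sup>*\<^sup>* (Some Rewind, map (\<lambda>c. c[0 := 0]) w, i, out)
      (Some (Eval q\<^sub>0), map (\<lambda>c. c[0 := 0]) w, 1, out)"
    using Suc.IH[of "map (\<lambda>c. c[0 := 0]) w"] Suc.prems by (simp add: comp_def)
  ultimately show ?case by (rule converse_rtranclp_into_rtranclp)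
qed

definition number :: "nat list list \<Rightarrow> nat" where
  "number w = (\<Sum>k<K. track B k w * (B ^ length w) ^ k)"

lemma track_bound:
  assumes "w \<in> lists (columns K B)" "k < K"
  shows "track B k w < B ^ length w"
  using assms by (intro track_less) (auto simp: in_lists_conv_set intro: columns_nth)

lemma number_less: "w \<in> lists (columns K B) \<Longrightarrow> number w < (B ^ length w) ^ K"
  unfolding number_def by (rule horner_less) (rule track_bound)

lemma tracks_number:
  assumes "w \<in> lists (columns K B)"
  shows "tracks B K w = digits (B ^ length w) K (number w)"
  unfolding tracks_def digits_def number_def
  using horner_digit[of K "\<lambda>k. track B k w", OF track_bound[OF assms]] by simp

text \<open>Track value \<open>p\<close> belongs to input cell \<open>p + 1\<close>, as cell 0 holds
  the left end marker. The head stops at the right end marker, which loses nothing: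
  \<open>read_input\<close> yields \<open>RightEnd\<close> at all later cells too.\<close>

definition ready :: "bool list \<Rightarrow> nat \<Rightarrow> nat \<Rightarrow> nat list list \<Rightarrow> nat \<Rightarrow> bool" where
  "ready x l m w i \<longleftrightarrow> w \<in> lists (columns K B) \<and> length w = l \<and> number w = m \<and>
     i = min (length x + 1) (track B (K - 2) w + 1)"

lemma clear_columns: "w \<in> lists (columns K B) \<Longrightarrow> map (\<lambda>c. c[0 := 0]) w \<in> lists (columns K B)"
  using B columns_update[of _ K B 0 0] by (auto simp: in_lists_conv_set)

lemma clear_track:
  assumes "w \<in> lists (columns K B)"
  shows "track B k (map (\<lambda>c. c[0 := 0]) w) = (if k = 0 then 0 else track B k w)"
  using assms K by (induction w) (auto simp: columns_def)

text \<open>The addition \<open>m + 1\<close> is delayed: before the pass over track \<open>k\<close>, the amount \<open>N ^ k\<close> has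
  still to be added to the number on the tape.\<close>

lemma increment:
  assumes "k < K" "w \<in> lists (columns K B)" "length w = l" "l < b"
    "number w + (B ^ l) ^ k = Suc m" "\<forall>j<k. track B j w = 0" "i \<le> length x + 1"
    "Suc k < K \<Longrightarrow> i = min (length x + 1) (track B (K - 2) w + 1)"
  shows "(\<exists>w' i'. ready x l (Suc m) w' i' \<and>
      (macro x b)\<^sup>*\<^sup>* (Some (Inc k True), w, i, out) (Some (Eval q\<^sub>0), w', i', out)) \<or>
    ((B ^ l) ^ K \<le> Suc m \<and> (\<exists>w' i'. (macro x b)\<^sup>*\<^sup>* (Some (Inc k True), w, i, out) (None, w', i', out)))"
  using assms
proof (induction "K - k" arbitrary: k w rule: less_induct)
  case less
  obtain carry w1 where bs: "bumps B k True w = (carry, w1)" by force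
  have dig: "\<forall>c\<in>set w. c ! k < B \<and> k < length c"
    using less.prems by (auto simp: in_lists_conv_set intro: columns_nth) (auto simp: columns_def)
  have t1: "track B k w1 + B ^ l * of_bool carry = track B k w + 1"
    using bumps_track[OF dig bs] less.prems by simp
  have len1: "length w1 = l" using bumps_length[of B k True w] bs less.prems by simp
  have col1: "w1 \<in> lists (columns K B)"
    using bumps_columns[of w K B B k True] less.prems B bs by simp
  have oth1: "track B j w1 = track B j w" if "j \<noteq> k" for j
    using bumps_track_other[OF that, of B B True w] bs by simp
  have sw: "sweep (Inc k True) w = (Inc k carry, w1)" using bs by (simp add: sweep_Inc)
  have num: "number v = track B k v * (B ^ l) ^ k + (\<Sum>j\<in>{..<K} - {k}. track B j v * (B ^ l) ^ j)"
    if "length v = l" for v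
    unfolding number_def that using less.prems(1) by (subst sum.remove[of _ k]) auto
  have "(\<Sum>j\<in>{..<K} - {k}. track B j w1 * (B ^ l) ^ j) = (\<Sum>j\<in>{..<K} - {k}. track B j w * (B ^ l) ^ j)"
    by (rule sum.cong) (auto simp: oth1)
  moreover have "(track B k w1 + B ^ l * of_bool carry) * (B ^ l) ^ k = (track B k w + 1) * (B ^ l) ^ k"
    using t1 by simp
  ultimately have num1: "number w1 + (B ^ l) ^ Suc k * of_bool carry = Suc m"
    using num[OF len1] num[OF less.prems(3)] less.prems(5) by (simp add: algebra_simps)
  show ?case
  proof (cases carry)
    case True
    have "track B k w < B ^ l" using track_bound less.prems by blast
    then have zero: "track B k w1 = 0" using t1 True by simp
    show ?thesis
    proof (cases "Suc k = K")
      case last: True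
      have "macro x b (Some (Inc k True), w, i, out) (None, w1, i, out)"
        by (rule macroI[OF sw, where d = Stay and o' = None])
          (use True last len1 less.prems in auto)
      moreover have "(B ^ l) ^ K \<le> Suc m" using num1 True last by auto
      ultimately show ?thesis by blast
    next
      case False
      have step: "macro x b (Some (Inc k True), w, i, out) (Some (Inc (Suc k) True), w1, i, out)"
        by (rule macroI[OF sw, where d = Stay and o' = None])
          (use True False len1 less.prems in auto)
      have "(\<exists>w' i'. ready x l (Suc m) w' i' \<and>
          (macro x b)\<^sup>*\<^sup>* (Some (Inc (Suc k) True), w1, i, out) (Some (Eval q\<^sub>0), w', i', out)) \<or>
        ((B ^ l) ^ K \<le> Suc m \<and>
          (\<exists>w' i'. (macro x b)\<^sup>*\<^sup>* (Some (Inc (Suc k) True), w1, i, out) (None, w', i', out)))"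
      proof (rule less.hyps)
        show "\<forall>j<Suc k. track B j w1 = 0" using zero oth1 less.prems by (auto simp: less_Suc_eq)
        show "number w1 + (B ^ l) ^ Suc k = Suc m" using num1 True by simp
        show "i = min (length x + 1) (track B (K - 2) w1 + 1)" if "Suc (Suc k) < K"
        proof -
          have "K - 2 \<noteq> k" using that by auto
          then show ?thesis using less.prems(8) that oth1 by simp
        qed
      qed (use False less.prems col1 len1 in auto)
      then show ?thesis using step by (meson converse_rtranclp_into_rtranclp)
    qed
  next
    case False
    then have num2: "number w1 = Suc m" using num1 by simp
    show ?thesis
    proof (cases "Suc k = K")
      case True
      let ?w = "map (\<lambda>c. c[0 := 0]) w1"
      have zero: "track B j w1 = 0" if "j < k" for j using that oth1 less.prems by auto
      have tr: "track B j ?w = track B j w1" for j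
        using clear_track[OF col1, of j] zero[of 0] True K by auto
      have "macro x b (Some (Inc k True), w, i, out) (Some Rewind, w1, i, out)"
        by (rule macroI[OF sw, where d = Stay and o' = None])
          (use False True len1 less.prems in auto)
      moreover have "(macro x b)\<^sup>*\<^sup>* (Some Rewind, w1, i, out) (Some (Eval q\<^sub>0), ?w, 1, out)"
        by (rule rewind) (use less.prems len1 in auto)
      ultimately have "(macro x b)\<^sup>*\<^sup>* (Some (Inc k True), w, i, out) (Some (Eval q\<^sub>0), ?w, 1, out)"
        by (rule converse_rtranclp_into_rtranclp)
      \<comment> \<open>The last track grows only after all lower ones have wrapped to 0, track
        \<open>K - 2\<close> among them; so the rewound head position 1 is the one that
        \<open>ready\<close> requires.\<close>
      moreover have "K - 2 < k" using True K by auto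
      then have "ready x l (Suc m) ?w 1"
        using num2 len1 clear_columns[OF col1] tr zero[of "K - 2"]
        by (simp add: ready_def number_def)
      ultimately show ?thesis by blast
    next
      case more: False
      let ?i = "min (length x + 1) (if Suc (Suc k) = K then Suc i else i)"
      have "macro x b (Some (Inc k True), w, i, out) (Some (Eval q\<^sub>0), w1, ?i, out)"
        by (rule macroI[OF sw, where d = "if Suc (Suc k) = K then Rt else Stay" and o' = None])
          (use False more len1 less.prems in auto)
      moreover have "?i = min (length x + 1) (track B (K - 2) w1 + 1)"
      proof (cases "Suc (Suc k) = K")
        case True
        then have "K - 2 = k" by auto
        then show ?thesis using True t1 False less.prems more by auto
      next
        case last: False
        then have "K - 2 \<noteq> k" using more less.prems by auto
        then show ?thesis using last oth1 less.prems more by auto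
      qed
      then have "ready x l (Suc m) w1 ?i" using num2 len1 col1 by (simp add: ready_def)
      ultimately show ?thesis by blast
    qed
  qed
qed

definition outputs :: "bool list \<Rightarrow> nat \<Rightarrow> (nat list \<Rightarrow> input_sym \<Rightarrow> bool option) \<Rightarrow> nat \<Rightarrow> bool list" where
  "outputs x n f m = emit (f (digits n K m) (read_input x (digits n K m ! (K - 2) + 1)))"

lemma loop:
  assumes f: "\<And>w. w \<in> lists (columns K B) \<Longrightarrow> f (tracks B K w) = result (foldl \<delta> q\<^sub>0 w)"
    and "ready x l m w i" "l < b"
  shows "\<exists>w' i'. (macro x b)\<^sup>*\<^sup>* (Some (Eval q\<^sub>0), w, i, out)
    (None, w', i', out @ concat (map (outputs x (B ^ l) f) [m..<(B ^ l) ^ K]))"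
  using assms(2)
proof (induction "(B ^ l) ^ K - m" arbitrary: m w i out rule: less_induct)
  case less
  then have w: "w \<in> lists (columns K B)" "length w = l" "number w = m"
    and i: "i = min (length x + 1) (track B (K - 2) w + 1)" by (auto simp: ready_def)
  have lt: "m < (B ^ l) ^ K" using number_less w by blast
  let ?o = "outputs x (B ^ l) f m"
  have "read_input x i = read_input x (track B (K - 2) w + 1)"
    unfolding i by (auto simp: read_input_def min_def)
  moreover have "track B (K - 2) w = digits (B ^ l) K m ! (K - 2)"
    using tracks_number[OF w(1)] w K nth_tracks[of "K - 2" K B w] by simp
  ultimately have o: "?o = emit (result (foldl \<delta> q\<^sub>0 w) (read_input x i))"
    using f[OF w(1)] tracks_number[OF w(1)] w by (simp add: outputs_def)
  have step: "macro x b (Some (Eval q\<^sub>0), w, i, out) (Some (Inc 0 True), w, i, out @ ?o)"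
    by (rule macroI[OF sweep_Eval, where d = Stay]) (use assms(3) w o i in auto)
  have up: "[m..<(B ^ l) ^ K] = m # [Suc m..<(B ^ l) ^ K]" using lt by (rule upt_conv_Cons)
  have "(\<exists>w' i'. ready x l (Suc m) w' i' \<and>
      (macro x b)\<^sup>*\<^sup>* (Some (Inc 0 True), w, i, out @ ?o) (Some (Eval q\<^sub>0), w', i', out @ ?o)) \<or>
    ((B ^ l) ^ K \<le> Suc m \<and>
      (\<exists>w' i'. (macro x b)\<^sup>*\<^sup>* (Some (Inc 0 True), w, i, out @ ?o) (None, w', i', out @ ?o)))"
    by (rule increment) (use K w assms(3) i in auto)
  then show ?case
  proof (elim disjE exE conjE)
    fix w' i'
    assume r: "ready x l (Suc m) w' i'"
      and s: "(macro x b)\<^sup>*\<^sup>* (Some (Inc 0 True), w, i, out @ ?o) (Some (Eval q\<^sub>0), w', i', out @ ?o)"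
    have "(B ^ l) ^ K - Suc m < (B ^ l) ^ K - m" using lt by simp
    from less.hyps[OF this r, of "out @ ?o"] obtain w2 i2 where
      "(macro x b)\<^sup>*\<^sup>* (Some (Eval q\<^sub>0), w', i', out @ ?o)
        (None, w2, i2, (out @ ?o) @ concat (map (outputs x (B ^ l) f) [Suc m..<(B ^ l) ^ K]))" by blast
    then have "(macro x b)\<^sup>*\<^sup>* (Some (Eval q\<^sub>0), w, i, out)
        (None, w2, i2, (out @ ?o) @ concat (map (outputs x (B ^ l) f) [Suc m..<(B ^ l) ^ K]))"
      using converse_rtranclp_into_rtranclp[OF step rtranclp_trans[OF s]] by blast
    then show ?thesis using up by auto
  next
    fix w' i'
    assume r: "(B ^ l) ^ K \<le> Suc m"
      and s: "(macro x b)\<^sup>*\<^sup>* (Some (Inc 0 True), w, i, out @ ?o) (None, w', i', out @ ?o)"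
    then show ?thesis using converse_rtranclp_into_rtranclp[OF step s] up by auto
  qed
qed

lemma run:
  assumes f: "\<And>w. w \<in> lists (columns K B) \<Longrightarrow> f (tracks B K w) = result (foldl \<delta> q\<^sub>0 w)"
    and bound: "\<And>l. 2 ^ l \<le> 4 * (length x + 2) \<Longrightarrow> l < b"
  shows "\<exists>l w i. length x + 2 < 2 ^ l \<and> (macro x b)\<^sup>*\<^sup>* (Some (Count True), [], 0, [])
    (None, w, i, concat (map (outputs x (B ^ l) f) [0..<(B ^ l) ^ K]))"
proof -
  obtain w where w: "(macro x b)\<^sup>*\<^sup>* (Some (Count True), [], 0, []) (Some Rewind, w, length x + 1, [])"
    "w \<in> lists (columns K B)" "length x + 2 < 2 ^ length w" "length w < b"
    "\<forall>j. 0 < j \<longrightarrow> j < K \<longrightarrow> track B j w = 0"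
    using count[of 0 x "[]" b] bound by auto
  let ?w = "map (\<lambda>c. c[0 := 0]) w"
  have "track B k ?w = 0" if "k < K" for k using clear_track[OF w(2), of k] w(5) that by auto
  then have "ready x (length w) 0 ?w 1"
    using clear_columns[OF w(2)] K by (simp add: ready_def number_def)
  from loop[OF f this w(4), of "[]"] obtain w' i where
    "(macro x b)\<^sup>*\<^sup>* (Some (Eval q\<^sub>0), ?w, 1, [])
      (None, w', i, concat (map (outputs x (B ^ length w) f) [0..<(B ^ length w) ^ K]))"
    by auto
  with w(1) rewind[of "length x + 1" x w b "[]"] w(4)
  have "(macro x b)\<^sup>*\<^sup>* (Some (Count True), [], 0, [])
      (None, w', i, concat (map (outputs x (B ^ length w) f) [0..<(B ^ length w) ^ K]))"
    by (meson order_refl rtranclp_trans)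
  then show ?thesis using w(3) by blast
qed

end

text \<open>The interface to the reduction: every regular function can be tabulated in logarithmic
  space. The length \<open>l\<close> is not chosen by the user of the lemma, who only learns a lower
  bound on \<open>2 ^ l x\<close> and controls the size through \<open>B\<close>.\<close>

lemma enumeration_logspace:
  fixes f :: "nat list \<Rightarrow> input_sym \<Rightarrow> bool option"
  assumes "2 \<le> B" "2 \<le> K" "regular B K f"
  obtains l where "\<And>x. length x + 2 < 2 ^ l x"
    and "logspace_computable (\<lambda>x. concat (map (\<lambda>m. emit (f (digits (B ^ l x) K m)
      (read_input x (digits (B ^ l x) K m ! (K - 2) + 1)))) [0..<(B ^ l x) ^ K]))"
proof -
  obtain S \<delta> q g where S: "finite (S :: nat set)" "q \<in> S" "\<forall>p\<in>S. \<forall>c\<in>columns K B. \<delta> p c \<in> S"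
    and f: "\<forall>w\<in>lists (columns K B). f (tracks B K w) = g (foldl \<delta> q w)"
    using assms(3) unfolding regular_def by blast
  interpret odometer B K S \<delta> q g
    by unfold_locales (use assms S in auto)
  define b where "b x = Suc (nat \<lfloor>log 2 (4 * (real (length x) + 2))\<rfloor>)" for x :: "bool list"
  have bound: "l < b x" if "2 ^ l \<le> 4 * (length x + 2)" for l x
  proof -
    have "real (2 ^ l) \<le> real (4 * (length x + 2))" using that of_nat_le_iff by blast
    then have "2 ^ l \<le> 4 * (real (length x) + 2)" by simp
    then have "real l \<le> log 2 (4 * (real (length x) + 2))" by (simp add: le_log_iff powr_realpow)
    then show ?thesis unfolding b_def by (simp add: le_nat_iff le_floor_iff less_Suc_eq_le)
  qed
  have "\<exists>l w i. length x + 2 < 2 ^ l \<and> (macro x (b x))\<^sup>*\<^sup>* (Some (Count True), [], 0, [])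
    (None, w, i, concat (map (outputs x (B ^ l) f) [0..<(B ^ l) ^ K]))" for x
    by (rule run) (use f bound in auto)
  then obtain l where l: "\<And>x. length x + 2 < 2 ^ l x \<and> (\<exists>w i. (macro x (b x))\<^sup>*\<^sup>* (Some (Count True), [], 0, [])
    (None, w, i, concat (map (outputs x (B ^ l x) f) [0..<(B ^ l x) ^ K])))" by metis
  \<comment> \<open>With \<open>y\<close> the logarithm on the right,
    \<open>b x \<le> 3 + y\<close>, and \<open>y \<ge> 1\<close> turns this into
    \<open>4 * y\<close>.\<close>
  have "real (b x) \<le> 4 * log 2 (real (length x) + 2)" for x
  proof -
    define y where "y = log 2 (real (length x) + 2)"
    have "log 2 2 \<le> y" unfolding y_def by (subst log_le_cancel_iff) auto
    then have "1 \<le> y" by simp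
    moreover have "real (b x) = 1 + real (nat \<lfloor>2 + y\<rfloor>)"
      unfolding b_def
      using log_mult[of 2 4 "real (length x) + 2"] log_pow_cancel[of 2 2] by (simp add: y_def)
    moreover have "real (nat \<lfloor>2 + y\<rfloor>) \<le> 2 + y" by (rule of_nat_floor) (use \<open>1 \<le> y\<close> in simp)
    ultimately show ?thesis unfolding y_def[symmetric] by linarith
  qed
  then have "logspace_computable (\<lambda>x. concat (map (outputs x (B ^ l x) f) [0..<(B ^ l x) ^ K]))"
    by (rule logspace_machine[rotated]) (use l in \<open>auto simp: b_def\<close>)
  then show ?thesis using that[of l] l unfolding outputs_def by blast
qed

section \<open>Frames as Horn clause sets\<close>

lemma validates_phi_h_iff:
  assumes "is_frame F"
  shows "validates F (phi_h (t :: 'v)) \<longleftrightarrow>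
    (\<forall>w\<in>worlds F.
      (\<forall>X\<subseteq>worlds F. \<exists>v. (w, v) \<in> acc F Base \<and>
        (\<forall>u. (v, u) \<in> acc F Minus \<longrightarrow> u \<in> X) \<and> (\<forall>u. (v, u) \<in> acc F Plus \<longrightarrow> u \<notin> X)) \<and>
      (\<forall>u u'. (w, u) \<in> acc F Plus \<longrightarrow> (w, u') \<in> acc F Plus \<longrightarrow> u = u'))" (is "_ \<longleftrightarrow> ?R")
proof
  assume val: "validates F (phi_h t)"
  show ?R
  proof (intro ballI conjI allI impI)
    fix w assume w: "w \<in> worlds F"
    have all: "holds F (\<lambda>_. X) w (phi_h t)" if "X \<subseteq> worlds F" for X
      using val[unfolded validates_def, rule_format, of "\<lambda>_. X" w] w that by simp
    show "\<exists>v. (w, v) \<in> acc F Base \<and>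
        (\<forall>u. (v, u) \<in> acc F Minus \<longrightarrow> u \<in> X) \<and> (\<forall>u. (v, u) \<in> acc F Plus \<longrightarrow> u \<notin> X)"
      if "X \<subseteq> worlds F" for X
      using all[OF that] by (simp add: phi_h_def)
    show "u = u'" if "(w, u) \<in> acc F Plus" "(w, u') \<in> acc F Plus" for u u'
    proof -
      \<comment> \<open>If \<open>t\<close> is true at \<open>u\<close> alone, the second conjunct
        of \<open>phi_h\<close> says that every \<open>Plus\<close>-successor is
        \<open>u\<close>.\<close>
      have "{u} \<subseteq> worlds F" using that assms by (auto simp: is_frame_def)
      from all[OF this] that show ?thesis by (auto simp: phi_h_def)
    qed
  qed
next
  assume R: ?R
  show "validates F (phi_h t)"
    unfolding validates_def
  proof (intro allI impI ballI)
    fix V :: "'v \<Rightarrow> _" and w assume V: "\<forall>p. V p \<subseteq> worlds F" and w: "w \<in> worlds F"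
    have "V t \<subseteq> worlds F" using V by blast
    with R w have "\<exists>v. (w, v) \<in> acc F Base \<and>
        (\<forall>u. (v, u) \<in> acc F Minus \<longrightarrow> u \<in> V t) \<and> (\<forall>u. (v, u) \<in> acc F Plus \<longrightarrow> u \<notin> V t)" by blast
    moreover have "\<And>u u'. (w, u) \<in> acc F Plus \<Longrightarrow> (w, u') \<in> acc F Plus \<Longrightarrow> u = u'"
      using R w by blast
    ultimately show "holds F V w (phi_h t)" by (simp add: phi_h_def) blast
  qed
qed

section \<open>The clauses describing a run\<close>

instance sym :: countable
  by countable_datatype

text \<open>\<open>State\<close> and \<open>Cell\<close> name variables, the other constructors name
  clauses. A single type lets one coordinate, coded by \<open>to_nat\<close>, serve both readings of
  a world.\<close>

datatype tag = State nat | Cell sym | Init_State | Init_Cell | Goal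
  | Write nat sym | Move nat sym | Keep nat sym

instance tag :: countable
  by countable_datatype

text \<open>A world has four coordinates \<open>(p, t, r, s)\<close>. Read as a variable, it has \<open>r = 0\<close> and says that
  at time \<open>t\<close> the head is at \<open>p\<close> in a given state, or that cell \<open>p\<close> contains a given symbol. Read as
  a clause, it also quantifies over a second position \<open>r\<close>. A literal describes the coordinates
  of a variable relative to those of the clause in which it occurs.\<close>

datatype position = At_Zero | At | At_Suc | At_Pred | At_Other

datatype time = Time_Zero | Now | Next

type_synonym literal = "position \<times> time \<times> tag"

text \<open>Truncated subtraction in \<open>At_Pred\<close> agrees with \<open>move\<close>: a left
  move in cell 0 stays there.\<close>

primrec place :: "position \<Rightarrow> nat \<Rightarrow> nat \<Rightarrow> nat" where
  "place At_Zero p r = 0"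
| "place At p r = p"
| "place At_Suc p r = Suc p"
| "place At_Pred p r = p - 1"
| "place At_Other p r = r"

primrec moment :: "time \<Rightarrow> nat \<Rightarrow> nat" where
  "moment Time_Zero t = 0"
| "moment Now t = t"
| "moment Next t = Suc t"

fun direction :: "dir \<Rightarrow> position" where
  "direction Lt = At_Pred"
| "direction Stay = At"
| "direction Rt = At_Suc"

lemma place_direction [simp]: "place (direction d) p r = move d p"
  by (cases d) auto

text \<open>Positions behind the input read \<open>RightEnd\<close>, and the tape of the machine is
  blank there.\<close>

fun written :: "input_sym \<Rightarrow> sym" where
  "written (InBit b) = Bit b"
| "written _ = Blank"

fun body :: "tm \<Rightarrow> tag \<Rightarrow> literal list" where
  "body M (Write q a) = [(At, Now, State q), (At, Now, Cell a)]"
| "body M (Move q a) = [(At, Now, State q), (At, Now, Cell a)]"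
| "body M (Keep q a) = [(At, Now, State q), (At_Other, Now, Cell a)]"
| "body M Goal = [(At, Now, State (tm_accept M))]"
| "body M _ = []"

text \<open>At most one literal, as \<open>Plus\<close> has to be functional. The empty head of
  \<open>Goal\<close> makes it the negative clause that acceptance violates. Only
  \<open>Init_Cell\<close> looks at the input symbol.\<close>

fun head :: "tm \<Rightarrow> input_sym \<Rightarrow> tag \<Rightarrow> literal list" where
  "head M i Init_State = [(At_Zero, Time_Zero, State (tm_start M))]"
| "head M i Init_Cell = [(At, Time_Zero, Cell (written i))]"
| "head M i (Write q a) = (case tm_delta M q a of (q', b, d) \<Rightarrow> [(At, Next, Cell b)])"
| "head M i (Move q a) = (case tm_delta M q a of (q', b, d) \<Rightarrow> [(direction d, Next, State q')])"
| "head M i (Keep q a) = [(At_Other, Next, Cell a)]"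
| "head M i _ = []"

text \<open>Halting states have no transition clauses. Hence a run that rejects in time demands
  nothing about times beyond the frame.\<close>

definition clauses :: "tm \<Rightarrow> tag set" where
  "clauses M = {Init_State, Init_Cell, Goal} \<union>
     (\<Union>q\<in>tm_states M - {tm_accept M, tm_reject M}. \<Union>a\<in>tm_alphabet M. {Write q a, Move q a, Keep q a})"

definition tags :: "tm \<Rightarrow> tag set" where
  "tags M = State ` tm_states M \<union> Cell ` tm_alphabet M \<union> clauses M"

lemma is_tm_facts:
  assumes "is_tm M"
  shows "finite (tm_states M)" "finite (tm_alphabet M)" "Blank \<in> tm_alphabet M" "Bit c \<in> tm_alphabet M"
    "tm_start M \<in> tm_states M" "tm_accept M \<in> tm_states M" "tm_accept M \<noteq> tm_reject M"
  using assms unfolding is_tm_def by (cases c; blast)+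

lemma is_tm_closed:
  assumes "is_tm M" "q \<in> tm_states M" "a \<in> tm_alphabet M" "tm_delta M q a = (q', b, d)"
  shows "q' \<in> tm_states M" "b \<in> tm_alphabet M"
  using assms unfolding is_tm_def by blast+

lemma finite_clauses: "is_tm M \<Longrightarrow> finite (clauses M)"
  by (simp add: clauses_def is_tm_facts)

lemma finite_tags: "is_tm M \<Longrightarrow> finite (tags M)"
  by (simp add: tags_def is_tm_facts finite_clauses)

type_synonym world = "nat \<times> nat \<times> nat \<times> nat"

fun occurs :: "literal list \<Rightarrow> world \<Rightarrow> world \<Rightarrow> bool" where
  "occurs ls (p, t, r, s) (p', t', r', s') \<longleftrightarrow>
     (\<exists>(e, f, \<tau>)\<in>set ls. p' = place e p r \<and> t' = moment f t \<and> r' = 0 \<and> s' = to_nat \<tau>)"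

fun is_clause :: "tm \<Rightarrow> world \<Rightarrow> bool" where
  "is_clause M (p, t, r, s) \<longleftrightarrow>
     (\<exists>\<tau>\<in>clauses M. s = to_nat \<tau> \<and> ((\<exists>q a. \<tau> = Keep q a) \<longrightarrow> p \<noteq> r))"

text \<open>\<open>Base\<close> ignores its source, so all worlds impose the same unsatisfiability
  condition. The input enters as one symbol \<open>a\<close> only; for each fixed \<open>a\<close>
  the relations can then be decided from the digits.\<close>

fun linked :: "tm \<Rightarrow> input_sym \<Rightarrow> modality \<Rightarrow> world \<Rightarrow> world \<Rightarrow> bool" where
  "linked M a Base u v \<longleftrightarrow> is_clause M v"
| "linked M a Plus u v \<longleftrightarrow>
     (\<exists>\<tau>\<in>clauses M. snd (snd (snd u)) = to_nat \<tau> \<and> occurs (head M a \<tau>) u v)"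
| "linked M a Minus u v \<longleftrightarrow>
     (\<exists>\<tau>\<in>clauses M. snd (snd (snd u)) = to_nat \<tau> \<and> occurs (body M \<tau>) u v)"

abbreviation related :: "tm \<Rightarrow> bool list \<Rightarrow> modality \<Rightarrow> world \<Rightarrow> world \<Rightarrow> bool" where
  "related M x m u v \<equiv> linked M (read_input x (Suc (fst u))) m u v"

section \<open>Worlds as numbers\<close>

fun world_number :: "nat \<Rightarrow> world \<Rightarrow> nat" where
  "world_number n (p, t, r, s) = ((p * n + t) * n + r) * n + s"

definition coordinates :: "nat \<Rightarrow> nat \<Rightarrow> world" where
  "coordinates n u = (u div n ^ 3 mod n, u div n ^ 2 mod n, u div n mod n, u mod n)"

definition horn_frame :: "tm \<Rightarrow> bool list \<Rightarrow> nat \<Rightarrow> nat frame" where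
  "horn_frame M x n = \<lparr>worlds = {..<n ^ 4},
     acc = (\<lambda>m. {(u, v). u < n ^ 4 \<and> v < n ^ 4 \<and> related M x m (coordinates n u) (coordinates n v)})\<rparr>"

fun bounded :: "nat \<Rightarrow> world \<Rightarrow> bool" where
  "bounded n (p, t, r, s) \<longleftrightarrow> p < n \<and> t < n \<and> r < n \<and> s < n"

lemma digit_less: "i * n + j < m * n" if "i < m" "j < (n::nat)"
proof -
  have "Suc i * n \<le> m * n" using that by (intro mult_le_mono1) simp
  then show ?thesis using that by simp
qed

lemma world_number_less: "bounded n c \<Longrightarrow> world_number n c < n ^ 4"
  by (cases c) (simp add: digit_less power4_eq_xxxx)

lemma coordinates_world_number:
  assumes "bounded n c" shows "coordinates n (world_number n c) = c"
proof -
  obtain p t r s where c: "c = (p, t, r, s)" by (cases c)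
  have b: "p < n" "t < n" "r < n" "s < n" using assms c by auto
  have 1: "world_number n c div n = (p * n + t) * n + r" using b c by simp
  have 2: "((p * n + t) * n + r) div n = p * n + t" "(p * n + t) div n = p" using b by auto
  have "world_number n c div n ^ 2 = p * n + t" "world_number n c div n ^ 3 = p"
    unfolding power2_eq_square power3_eq_cube div_mult2_eq 1 2 by (rule refl)+
  then show ?thesis using 1 b c by (simp add: coordinates_def)
qed

lemma bounded_coordinates: "u < n ^ 4 \<Longrightarrow> bounded n (coordinates n u)"
  by (cases n) (auto simp: coordinates_def)

lemma world_number_coordinates:
  assumes "u < n ^ 4" shows "world_number n (coordinates n u) = u"
proof -
  have "u div n ^ 3 < n" using assms
    by (intro less_mult_imp_div_less) (simp add: power4_eq_xxxx power3_eq_cube mult.assoc)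
  then have "u div n ^ 3 mod n = u div n ^ 3" by simp
  moreover have "u div n ^ 3 = u div n div n div n" "u div n ^ 2 = u div n div n"
    by (simp_all add: power2_eq_square power3_eq_cube div_mult2_eq)
  ultimately show ?thesis by (simp add: coordinates_def)
qed

lemma all_worlds: "(\<forall>u<n ^ 4. P (coordinates n u)) \<longleftrightarrow> (\<forall>c. bounded n c \<longrightarrow> P c)"
  by (metis bounded_coordinates coordinates_world_number world_number_less)

lemma is_frame_horn_frame: "0 < n \<Longrightarrow> is_frame (horn_frame M x n)"
  by (auto simp: is_frame_def horn_frame_def lessThan_empty_iff)

section \<open>Runs and models of the clauses\<close>

definition config :: "tm \<Rightarrow> bool list \<Rightarrow> nat \<Rightarrow> tm_config" where
  "config M x t = (tm_step M ^^ t) (tm_init M x)"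

lemma config_Suc: "config M x (Suc t) = tm_step M (config M x t)"
  by (simp add: config_def)

lemma config_wf:
  assumes "is_tm M"
  shows "tc_state (config M x t) \<in> tm_states M \<and> tc_tape (config M x t) p \<in> tm_alphabet M \<and>
    tc_head (config M x t) \<le> t"
proof (induction t arbitrary: p)
  case 0
  then show ?case using is_tm_facts[OF assms] by (auto simp: config_def tm_init_def)
next
  case (Suc t)
  let ?c = "config M x t"
  obtain q b d where e: "tm_delta M (tc_state ?c) (tc_tape ?c (tc_head ?c)) = (q, b, d)"
    by (metis prod_cases3)
  have "q \<in> tm_states M" "b \<in> tm_alphabet M"
    using is_tm_closed[OF assms _ _ e] Suc by auto
  moreover have "move d (tc_head ?c) \<le> Suc t" using Suc by (cases d) (auto intro: le_SucI le_trans[OF diff_le_self])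
  ultimately show ?case using Suc e by (auto simp: config_Suc tm_step_def le_SucI)
qed

lemma config_halted:
  assumes "tc_state (config M x k) \<in> {tm_accept M, tm_reject M}" "k \<le> t"
  shows "config M x t = config M x k"
  using assms(2)
proof (induction t rule: dec_induct)
  case (step t)
  then show ?case using assms(1) by (simp add: config_Suc tm_step_def)
qed simp

definition true_at :: "tm \<Rightarrow> bool list \<Rightarrow> world \<Rightarrow> bool" where
  "true_at M x = (\<lambda>(p, t, r, s).
     (\<exists>q. s = to_nat (State q) \<and> tc_head (config M x t) = p \<and> tc_state (config M x t) = q) \<or>
     (\<exists>a. s = to_nat (Cell a) \<and> tc_tape (config M x t) p = a))"

lemma true_at_State [simp]: "true_at M x (p, t, r, to_nat (State q)) \<longleftrightarrow>
    tc_head (config M x t) = p \<and> tc_state (config M x t) = q"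
  by (auto simp: true_at_def)

lemma true_at_Cell [simp]: "true_at M x (p, t, r, to_nat (Cell a)) \<longleftrightarrow> tc_tape (config M x t) p = a"
  by (auto simp: true_at_def)

lemma config_step:
  assumes "tc_state (config M x t) \<notin> {tm_accept M, tm_reject M}"
    "tm_delta M (tc_state (config M x t)) (tc_tape (config M x t) (tc_head (config M x t))) = (q, b, d)"
  shows "config M x (Suc t) = \<lparr>tc_state = q, tc_head = move d (tc_head (config M x t)),
    tc_tape = (tc_tape (config M x t))(tc_head (config M x t) := b)\<rparr>"
  using assms by (simp add: config_Suc tm_step_def)

lemma written_read: "written (read_input x (Suc p)) = tc_tape (config M x 0) p"
  by (simp add: config_def tm_init_def read_input_def)

text \<open>Restriction to bounded worlds removes literals whose coordinates reach \<open>n\<close>.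
  Premises use the position and time of the clause itself, so, once \<open>n\<close> exceeds all tag
  codes, only a conclusion can be lost; the clause then becomes negative.\<close>

definition model :: "tm \<Rightarrow> bool list \<Rightarrow> nat \<Rightarrow> world set \<Rightarrow> bool" where
  "model M x n X \<longleftrightarrow> (\<forall>v. bounded n v \<longrightarrow> is_clause M v \<longrightarrow>
     (\<forall>u. bounded n u \<longrightarrow> related M x Minus v u \<longrightarrow> u \<in> X) \<longrightarrow>
     (\<exists>u. bounded n u \<and> related M x Plus v u \<and> u \<in> X))"

lemma occurs_unique:
  assumes "length ls \<le> 1" "occurs ls u v" "occurs ls u v'"
  shows "v = v'"
proof -
  obtain e f \<tau> where "ls = [(e, f, \<tau>)]"
    using assms by (cases u; cases v; cases ls) auto
  with assms(2,3) show ?thesis by (cases u; cases v; cases v') simp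
qed

lemma length_head: "length (head M i \<tau>) \<le> 1"
  by (cases \<tau>; cases i) (simp_all split: prod.splits)

lemma Plus_unique:
  assumes "related M x Plus u v" "related M x Plus u v'"
  shows "v = v'"
proof -
  obtain \<tau> \<tau>' where "to_nat \<tau> = to_nat \<tau>'"
    and "occurs (head M (read_input x (Suc (fst u))) \<tau>) u v"
    and "occurs (head M (read_input x (Suc (fst u))) \<tau>') u v'"
    using assms unfolding linked.simps by metis
  then show ?thesis using occurs_unique[OF length_head] by (metis from_nat_to_nat)
qed

text \<open>As \<open>Base\<close> ignores its source, the condition is the same at every world, and
  functionality of \<open>Plus\<close> is \<open>Plus_unique\<close>. What remains is a change from
  numbers to quadruples.\<close>

lemma validates_horn_frame:
  assumes n: "0 < n"
  shows "validates (horn_frame M x n) (phi_h (z :: 'v)) \<longleftrightarrow> (\<nexists>X. model M x n X)"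
proof -
  let ?F = "horn_frame M x n" and ?R = "related M x"
  have "validates ?F (phi_h z) \<longleftrightarrow>
    (\<forall>X\<subseteq>{..<n ^ 4}. \<exists>v<n ^ 4. is_clause M (coordinates n v) \<and>
        (\<forall>u<n ^ 4. ?R Minus (coordinates n v) (coordinates n u) \<longrightarrow> u \<in> X) \<and>
        (\<forall>u<n ^ 4. ?R Plus (coordinates n v) (coordinates n u) \<longrightarrow> u \<notin> X))" (is "_ \<longleftrightarrow> ?U")
  proof -
    have "u = u'" if "u < n ^ 4" "u' < n ^ 4" "?R Plus (coordinates n w) (coordinates n u)"
      "?R Plus (coordinates n w) (coordinates n u')" for w u u'
      using Plus_unique[OF that(3,4)] that(1,2) by (metis world_number_coordinates)
    moreover have "0 < n ^ 4" using n by simp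
    \<comment> \<open>Discharges functionality and drops the quantifier over \<open>w\<close>, which
      ranges over a nonempty set because \<open>0 < n\<close>.\<close>
    ultimately have 1: "(\<forall>w<n ^ 4. Q \<and> (\<forall>u u'. w < n ^ 4 \<and> u < n ^ 4 \<and> ?R Plus (coordinates n w) (coordinates n u) \<longrightarrow>
      w < n ^ 4 \<and> u' < n ^ 4 \<and> ?R Plus (coordinates n w) (coordinates n u') \<longrightarrow> u = u')) \<longleftrightarrow> Q" for Q
      by metis
    have "validates ?F (phi_h z) \<longleftrightarrow> (\<forall>w<n ^ 4. ?U \<and>
      (\<forall>u u'. w < n ^ 4 \<and> u < n ^ 4 \<and> ?R Plus (coordinates n w) (coordinates n u) \<longrightarrow>
        w < n ^ 4 \<and> u' < n ^ 4 \<and> ?R Plus (coordinates n w) (coordinates n u') \<longrightarrow> u = u'))"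
      unfolding validates_phi_h_iff[OF is_frame_horn_frame[OF n]]
      by (simp add: horn_frame_def Ball_def imp_conjL del: linked.simps(2,3) cong: conj_cong)
    then show ?thesis unfolding 1 .
  qed
  also have "?U \<longleftrightarrow> (\<nexists>X. model M x n X)"
  proof (intro iffI notI)
    assume U: ?U and "\<exists>X. model M x n X"
    then obtain X where X: "model M x n X" by blast
    let ?X = "{u. u < n ^ 4 \<and> coordinates n u \<in> X}"
    have "?X \<subseteq> {..<n ^ 4}" by auto
    from U[rule_format, OF this] obtain v where v: "v < n ^ 4" "is_clause M (coordinates n v)"
      and "\<forall>u<n ^ 4. ?R Minus (coordinates n v) (coordinates n u) \<longrightarrow> coordinates n u \<in> X"
      and "\<forall>u<n ^ 4. ?R Plus (coordinates n v) (coordinates n u) \<longrightarrow> coordinates n u \<notin> X"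
      by blast
    then have "\<forall>u. bounded n u \<longrightarrow> ?R Minus (coordinates n v) u \<longrightarrow> u \<in> X"
      "\<forall>u. bounded n u \<longrightarrow> ?R Plus (coordinates n v) u \<longrightarrow> u \<notin> X"
      using all_worlds[of n "\<lambda>u. ?R Minus (coordinates n v) u \<longrightarrow> u \<in> X"]
        all_worlds[of n "\<lambda>u. ?R Plus (coordinates n v) u \<longrightarrow> u \<notin> X"] by blast+
    then show False using X v bounded_coordinates[of v n] unfolding model_def by blast
  next
    assume V: "\<nexists>X. model M x n X"
    show ?U
    proof (intro allI impI)
      fix X assume X: "X \<subseteq> {..<n ^ 4}"
      from V obtain v where v: "bounded n v" "is_clause M v"
        and minus: "\<And>u. bounded n u \<Longrightarrow> ?R Minus v u \<Longrightarrow> u \<in> coordinates n ` X"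
        and plus: "\<And>u. bounded n u \<Longrightarrow> ?R Plus v u \<Longrightarrow> u \<notin> coordinates n ` X"
        unfolding model_def by meson
      have in_X: "u \<in> X" if "u < n ^ 4" "coordinates n u \<in> coordinates n ` X" for u
        using that X by (metis imageE lessThan_iff subsetD world_number_coordinates)
      have "\<forall>u<n ^ 4. ?R Minus v (coordinates n u) \<longrightarrow> u \<in> X"
        using minus in_X bounded_coordinates by blast
      moreover have "\<forall>u<n ^ 4. ?R Plus v (coordinates n u) \<longrightarrow> u \<notin> X"
        using plus bounded_coordinates by blast
      ultimately show "\<exists>v<n ^ 4. is_clause M (coordinates n v) \<and>
        (\<forall>u<n ^ 4. ?R Minus (coordinates n v) (coordinates n u) \<longrightarrow> u \<in> X) \<and>
        (\<forall>u<n ^ 4. ?R Plus (coordinates n v) (coordinates n u) \<longrightarrow> u \<notin> X)"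
        using v coordinates_world_number[OF v(1)] world_number_less[OF v(1)]
        by (intro exI[of _ "world_number n v"]) (simp del: linked.simps)
    qed
  qed
  finally show ?thesis .
qed

text \<open>The facts true of the actual run form a model: they obey the initial and transition
  clauses by construction, and \<open>Goal\<close> because a rejecting run never accepts.\<close>

lemma model_if_rejecting:
  assumes tm: "is_tm M" and k: "k < n" and rej: "tc_state (config M x k) = tm_reject M"
    and tags: "\<And>\<tau>. \<tau> \<in> tags M \<Longrightarrow> to_nat \<tau> < n"
  shows "model M x n (Collect (true_at M x))"
proof -
  let ?R = "related M x"
  have n: "0 < n" using k by simp
  have neq: "tm_accept M \<noteq> tm_reject M" by (rule is_tm_facts(7)[OF tm])
  \<comment> \<open>The frame lacks a conclusion whose coordinates reach \<open>n\<close>; this makes the body of such a clause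
    false.\<close>
  have run: "Suc t < n" if "tc_state (config M x t) \<notin> {tm_accept M, tm_reject M}" for t
    using config_halted[of M x k t] rej that k by (cases "k \<le> t") auto
  have no_accept: "tc_state (config M x t) \<noteq> tm_accept M" for t
    using config_halted[of M x k t] config_halted[of M x t k] rej neq by (metis insertI1 insertI2 nle_le)
  have False if v: "bounded n (p, t, r, s)" "is_clause M (p, t, r, s)"
    and minus: "\<And>u. bounded n u \<Longrightarrow> ?R Minus (p, t, r, s) u \<Longrightarrow> true_at M x u"
    and plus: "\<And>u. bounded n u \<Longrightarrow> ?R Plus (p, t, r, s) u \<Longrightarrow> \<not> true_at M x u" for p t r s
  proof -
    from v(2) obtain \<tau> where \<tau>: "\<tau> \<in> clauses M" "s = to_nat \<tau>" "(\<exists>q a. \<tau> = Keep q a) \<longrightarrow> p \<noteq> r"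
      by auto
    have m: "true_at M x (place e p r, moment f t, 0, to_nat \<sigma>)"
      if hyp: "(e, f, \<sigma>) \<in> set (body M \<tau>)" "place e p r < n" "moment f t < n" "\<sigma> \<in> tags M" for e f \<sigma>
      by (rule minus) (use that \<tau> tags n in auto)
    have pl: "\<not> true_at M x (place e p r, moment f t, 0, to_nat \<sigma>)"
      if hyp: "(e, f, \<sigma>) \<in> set (head M (read_input x (Suc p)) \<tau>)" "place e p r < n" "moment f t < n" "\<sigma> \<in> tags M" for e f \<sigma>
      by (rule plus) (use that \<tau> tags n in auto)
    note wf = config_wf[OF tm, of x]
    have b: "p < n" "t < n" "r < n" using v by auto
    have st: "q \<in> tm_states M \<Longrightarrow> State q \<in> tags M" "a \<in> tm_alphabet M \<Longrightarrow> Cell a \<in> tags M" for q a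
      by (auto simp: tags_def)
    have acc: "tm_accept M \<in> tm_states M" "tm_start M \<in> tm_states M" using is_tm_facts[OF tm] by auto
    show False
    proof (cases \<tau>)
      case Init_State
      then show False using pl[of At_Zero Time_Zero "State (tm_start M)"] n st acc
        by (simp add: config_def tm_init_def)
    next
      case Init_Cell
      have "written (read_input x (Suc p)) \<in> tm_alphabet M" using wf[of 0 p] written_read[of x p M] by simp
      then show False using pl[of At Time_Zero "Cell (written (read_input x (Suc p)))"] n st b Init_Cell
        by (simp add: written_read[of x p M])
    next
      case Goal
      then show False using m[of At Now "State (tm_accept M)"] b st acc no_accept by simp
    next
      case (Write q a)
      then have q: "q \<in> tm_states M" "a \<in> tm_alphabet M" "q \<notin> {tm_accept M, tm_reject M}"
        using \<tau> by (auto simp: clauses_def)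
      have c: "tc_head (config M x t) = p" "tc_state (config M x t) = q" "tc_tape (config M x t) p = a"
        using m[of At Now "State q"] m[of At Now "Cell a"] Write b st q by auto
      obtain q' b' d where e: "tm_delta M q a = (q', b', d)" by (metis prod_cases3)
      have "b' \<in> tm_alphabet M" using is_tm_closed[OF tm q(1,2) e] by simp
      moreover have "Suc t < n" using run[of t] c q by simp
      ultimately show False using pl[of At Next "Cell b'"] config_step[of M x t q' b' d] c q e Write b st by simp
    next
      case (Move q a)
      then have q: "q \<in> tm_states M" "a \<in> tm_alphabet M" "q \<notin> {tm_accept M, tm_reject M}"
        using \<tau> by (auto simp: clauses_def)
      have c: "tc_head (config M x t) = p" "tc_state (config M x t) = q" "tc_tape (config M x t) p = a"
        using m[of At Now "State q"] m[of At Now "Cell a"] Move b st q by auto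
      obtain q' b' d where e: "tm_delta M q a = (q', b', d)" by (metis prod_cases3)
      have "q' \<in> tm_states M" using is_tm_closed[OF tm q(1,2) e] by simp
      moreover have T: "Suc t < n" using run[of t] c q by simp
      \<comment> \<open>After \<open>Suc t\<close> steps the head is at most at
        \<open>Suc t\<close>, so the position in the conclusion stays inside the frame.\<close>
      moreover have "move d p < n" using config_step[of M x t q' b' d] c q e wf[of "Suc t" 0] T by simp
      ultimately show False using pl[of "direction d" Next "State q'"] config_step[of M x t q' b' d] c q e Move b st
        by simp
    next
      case (Keep q a)
      then have q: "q \<in> tm_states M" "a \<in> tm_alphabet M" "q \<notin> {tm_accept M, tm_reject M}"
        using \<tau> by (auto simp: clauses_def)
      have c: "tc_head (config M x t) = p" "tc_state (config M x t) = q" "tc_tape (config M x t) r = a"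
        using m[of At Now "State q"] m[of At_Other Now "Cell a"] Keep b st q by auto
      obtain q' b' d where e: "tm_delta M q (tc_tape (config M x t) p) = (q', b', d)" by (metis prod_cases3)
      have "Suc t < n" using run[of t] c q by simp
      moreover have "p \<noteq> r" using \<tau> Keep by blast
      ultimately show False using pl[of At_Other Next "Cell a"] config_step[of M x t q' b' d] c q e Keep b st
        by simp
    qed (use \<tau> in \<open>auto simp: clauses_def\<close>)
  qed
  then show ?thesis unfolding model_def by fast
qed

text \<open>Forward chaining: by induction on time every model contains the facts true of the run,
  up to the accepting configuration. There the premise of \<open>Goal\<close> holds, but it has no
  conclusion.\<close>

lemma not_model_if_accepting:
  assumes tm: "is_tm M" and k: "k < n" and accept: "tc_state (config M x k) = tm_accept M"
    and tags: "\<And>\<tau>. \<tau> \<in> tags M \<Longrightarrow> to_nat \<tau> < n"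
    and model: "model M x n X"
  shows False
proof -
  let ?R = "related M x"
  have n: "0 < n" using k by simp
  have neq: "tm_accept M \<noteq> tm_reject M" by (rule is_tm_facts(7)[OF tm])
  have X: "\<exists>u. bounded n u \<and> ?R Plus v u \<and> u \<in> X"
    if "bounded n v" "is_clause M v" "\<And>u. bounded n u \<Longrightarrow> ?R Minus v u \<Longrightarrow> u \<in> X" for v
    using model that unfolding model_def by blast
  have fire: "\<exists>(e, f, \<sigma>)\<in>set (head M (read_input x (Suc p)) \<tau>). (place e p r, moment f t, 0, to_nat \<sigma>) \<in> X"
    if "\<tau> \<in> clauses M" "p < n" "t < n" "r < n" "(\<exists>q a. \<tau> = Keep q a) \<longrightarrow> p \<noteq> r"
      "\<forall>(e, f, \<sigma>)\<in>set (body M \<tau>). (place e p r, moment f t, 0, to_nat \<sigma>) \<in> X" for \<tau> p t r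
  proof -
    have "to_nat \<tau> < n" using that(1) tags by (auto simp: tags_def)
    then have "\<exists>u. bounded n u \<and> ?R Plus (p, t, r, to_nat \<tau>) u \<and> u \<in> X"
      using that by (intro X) auto
    then show ?thesis by auto
  qed
  have "(tc_head (config M x t), t, 0, to_nat (State (tc_state (config M x t)))) \<in> X \<and>
    (\<forall>p<n. (p, t, 0, to_nat (Cell (tc_tape (config M x t) p))) \<in> X)" if "t \<le> k" for t
    using that
  proof (induction t)
    case 0
    have "(tc_head (config M x 0), 0, 0, to_nat (State (tc_state (config M x 0)))) \<in> X"
      using fire[of Init_State 0 0 0] n by (simp add: clauses_def config_def tm_init_def)
    moreover have "(p, 0, 0, to_nat (Cell (tc_tape (config M x 0) p))) \<in> X" if "p < n" for p
      using fire[of Init_Cell p 0 0] n that by (simp add: clauses_def written_read[of x p M])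
    ultimately show ?case by blast
  next
    case (Suc t)
    let ?c = "config M x t"
    let ?p = "tc_head ?c" and ?q = "tc_state ?c"
    have IH: "(?p, t, 0, to_nat (State ?q)) \<in> X" "\<And>p. p < n \<Longrightarrow> (p, t, 0, to_nat (Cell (tc_tape ?c p))) \<in> X"
      using Suc by auto
    have t: "t < n" "Suc t < n" and p: "?p < n" using Suc.prems k config_wf[OF tm, of x t 0] by auto
    \<comment> \<open>A configuration halted before time \<open>k\<close> persists until
      \<open>k\<close>, hence accepts, and then \<open>Goal\<close> already contradicts the model.
      So the transition clauses of \<open>?q\<close> are available.\<close>
    have run: "?q \<notin> {tm_accept M, tm_reject M}"
    proof
      assume h: "?q \<in> {tm_accept M, tm_reject M}"
      then have "?q = tm_accept M" using config_halted[OF h, of k] Suc.prems accept neq by auto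
      then show False using fire[of Goal ?p t 0] IH(1) p t n by (simp add: clauses_def)
    qed
    have wf: "?q \<in> tm_states M" "tc_tape ?c p \<in> tm_alphabet M" for p using config_wf[OF tm, of x t] by auto
    obtain q b d where e: "tm_delta M ?q (tc_tape ?c ?p) = (q, b, d)" by (metis prod_cases3)
    note step = config_step[OF run e]
    have "Write ?q (tc_tape ?c ?p) \<in> clauses M" "Move ?q (tc_tape ?c ?p) \<in> clauses M"
      using run wf by (auto simp: clauses_def)
    then have 1: "(?p, Suc t, 0, to_nat (Cell b)) \<in> X" "(move d ?p, Suc t, 0, to_nat (State q)) \<in> X"
      using fire[of "Write ?q (tc_tape ?c ?p)" ?p t 0] fire[of "Move ?q (tc_tape ?c ?p)" ?p t 0]
        IH p t n e by auto
    \<comment> \<open>The clause \<open>Keep\<close> is taken with the head as first and the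
      untouched cell \<open>r\<close> as second position.\<close>
    have 2: "(r, Suc t, 0, to_nat (Cell (tc_tape ?c r))) \<in> X" if "r < n" "r \<noteq> ?p" for r
    proof -
      have "Keep ?q (tc_tape ?c r) \<in> clauses M" using run wf by (auto simp: clauses_def)
      then show ?thesis using fire[of "Keep ?q (tc_tape ?c r)" ?p t r] IH p t that by auto
    qed
    show ?case using 1 2 by (auto simp: step)
  qed
  from this[of k] accept have "(tc_head (config M x k), k, 0, to_nat (State (tm_accept M))) \<in> X" by auto
  moreover have "tc_head (config M x k) < n" using config_wf[OF tm, of x k] k by (meson le_less_trans)
  ultimately show ?thesis using fire[of Goal "tc_head (config M x k)" k 0] k n
    by (simp add: clauses_def)
qed

lemma validates_horn_frame_iff:
  assumes "is_tm M" "k < n" "tc_state (config M x k) = (if x \<in> A then tm_accept M else tm_reject M)"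
    and "\<And>\<tau>. \<tau> \<in> tags M \<Longrightarrow> to_nat \<tau> < n"
  shows "validates (horn_frame M x n) (phi_h z) \<longleftrightarrow> x \<in> A"
  using validates_horn_frame[of n M x z] model_if_rejecting[OF assms(1,2)]
    not_model_if_accepting[OF assms(1,2)] assms by (cases "x \<in> A") auto

section \<open>Writing the frame in logarithmic space\<close>

text \<open>The position sits on the highest of the four tracks. For the row, on tracks 4 to 7, this
  is track 7, the one that the input head follows when there are nine tracks.\<close>

definition world_at :: "nat list \<Rightarrow> nat \<Rightarrow> world" where
  "world_at v k = (v ! (k + 3), v ! (k + 2), v ! (k + 1), v ! k)"

lemma world_at_0: "world_at v 0 = (v ! 3, v ! 2, v ! 1, v ! 0)"
  by (simp add: world_at_def numeral_2_eq_2)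

lemma world_at_4: "world_at v 4 = (v ! 7, v ! 6, v ! 5, v ! 4)"
  by (simp add: world_at_def)

text \<open>Tracks 0 to 3 hold the column, tracks 4 to 7 the row, and track 8 says which part of the
  encoding is being written.\<close>

definition encoding_bit :: "tm \<Rightarrow> nat list \<Rightarrow> input_sym \<Rightarrow> bool option" where
  "encoding_bit M v a =
     (if v ! 8 = 0 then if world_at v 4 = (0, 0, 0, 0) then Some True else None
      else if v ! 8 = 1 then
        if world_at v 4 = (0, 0, 0, 0) \<and> world_at v 0 = (0, 0, 0, 0) then Some False else None
      else if v ! 8 = 2 then Some (linked M a Base (world_at v 4) (world_at v 0))
      else if v ! 8 = 3 then Some (linked M a Plus (world_at v 4) (world_at v 0))
      else if v ! 8 = 4 then Some (linked M a Minus (world_at v 4) (world_at v 0))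
      else None)"

lemma regular_place:
  assumes "i < K" "j < K" "k < K"
  shows "regular b K (\<lambda>v. v ! i = place e (v ! j) (v ! k))"
proof (cases e)
  case At_Pred
  have "(\<lambda>v. v ! i = v ! j - 1) = (\<lambda>v. v ! j = Suc (v ! i) \<or> v ! j = 0 \<and> v ! i = (0::nat))"
    by (auto simp: fun_eq_iff)
  then show ?thesis using assms At_Pred
    by (simp add: regular_or regular_and regular_eq_Suc regular_eq_const)
qed (use assms in \<open>simp_all add: regular_eq regular_eq_Suc regular_eq_const\<close>)

lemma regular_moment:
  assumes "i < K" "j < K"
  shows "regular b K (\<lambda>v. v ! i = moment e (v ! j))"
  using assms by (cases e) (simp_all add: regular_eq regular_eq_Suc regular_eq_const)

lemma regular_occurs: "regular b 9 (\<lambda>v. occurs ls (world_at v 4) (world_at v 0))"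
proof -
  have "regular b 9 (\<lambda>v. \<exists>l\<in>set ls. v ! 3 = place (fst l) (v ! 7) (v ! 5) \<and>
      v ! 2 = moment (fst (snd l)) (v ! 6) \<and> v ! 1 = 0 \<and> v ! 0 = to_nat (snd (snd l)))"
    by (intro regular_bex regular_and regular_place regular_moment regular_eq_const) auto
  then show ?thesis by (simp add: world_at_0 world_at_4 case_prod_beta)
qed

text \<open>The relation is a disjunction over the finitely many clauses of \<open>M\<close>, and
  each disjunct compares tracks with each other, up to a successor, or with constants. So one
  automaton serves all inputs.\<close>

lemma regular_linked:
  assumes "is_tm M"
  shows "regular b 9 (\<lambda>v. linked M a m (world_at v 4) (world_at v 0))"
proof (cases m)
  case Base
  have "regular b 9 (\<lambda>v. \<exists>\<tau>\<in>clauses M. v ! 0 = to_nat \<tau> \<and> ((\<nexists>q a. \<tau> = Keep q a) \<or> v ! 3 \<noteq> v ! 1))"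
    by (intro regular_bex finite_clauses assms regular_and regular_or regular_not regular_const
        regular_eq regular_eq_const) auto
  then show ?thesis by (simp add: Base world_at_0 imp_conv_disj)
next
  case Plus
  have "regular b 9 (\<lambda>v. \<exists>\<tau>\<in>clauses M. v ! 4 = to_nat \<tau> \<and> occurs (head M a \<tau>) (world_at v 4) (world_at v 0))"
    by (intro regular_bex finite_clauses assms regular_and regular_occurs regular_eq_const) auto
  moreover have "snd (snd (snd (world_at v 4))) = v ! 4" for v by (simp add: world_at_def)
  ultimately show ?thesis by (simp add: Plus)
next
  case Minus
  have "regular b 9 (\<lambda>v. \<exists>\<tau>\<in>clauses M. v ! 4 = to_nat \<tau> \<and> occurs (body M \<tau>) (world_at v 4) (world_at v 0))"
    by (intro regular_bex finite_clauses assms regular_and regular_occurs regular_eq_const) auto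
  moreover have "snd (snd (snd (world_at v 4))) = v ! 4" for v by (simp add: world_at_def)
  ultimately show ?thesis by (simp add: Minus)
qed

lemma regular_world_at_zero:
  "k + 3 < K \<Longrightarrow> regular b K (\<lambda>v. world_at v k = (0, 0, 0, 0))"
  by (simp add: world_at_def regular_and regular_eq_const)

lemma regular_encoding_bit:
  assumes "is_tm M" shows "regular b 9 (encoding_bit M)"
proof (rule regular_input_sym)
  fix a
  have linked: "regular b 9 (\<lambda>v. Some (linked M a m (world_at v 4) (world_at v 0)))" for m
    using regular_apply2[OF regular_linked[OF assms] regular_linked[OF assms], where h = "\<lambda>y _. Some y"] .
  show "regular b 9 (\<lambda>v. encoding_bit M v a)" unfolding encoding_bit_def
    by (intro regular_if regular_and regular_world_at_zero regular_eq_const regular_const linked) auto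
qed

section \<open>The enumeration yields the encoding of the frame\<close>

lemma concat_map_upt_mult:
  "concat (map f [0..<a * b]) = concat (map (\<lambda>i. concat (map (\<lambda>j. f (i * b + j)) [0..<b])) [0..<a])"
proof (induction a)
  case (Suc a)
  have "[0..<Suc a * b] = [0..<a * b] @ map (\<lambda>j. a * b + j) [0..<b]"
    using upt_add_eq_append[of 0 "a * b" b] map_add_upt[of "a * b" b] by (simp add: add.commute)
  then show ?case using Suc by (simp add: comp_def)
qed simp

lemma digit_low:
  fixes i j n :: nat
  assumes "k < l" shows "(i * n ^ l + j) div n ^ k mod n = j div n ^ k mod n"
proof (cases "n = 0")
  case False
  obtain e where "l = k + Suc e" using assms less_imp_Suc_add[of k l] by auto
  then have "i * n ^ l + j = j + n ^ k * (n * (i * n ^ e))" by (simp add: power_add)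
  also have "\<dots> div n ^ k = j div n ^ k + n * (i * n ^ e)" using False by simp
  finally show ?thesis by simp
qed (use assms in \<open>auto simp: power_0_left\<close>)

lemma digit_high:
  fixes i j n :: nat
  assumes "j < n ^ l" shows "(i * n ^ l + j) div n ^ (l + k) mod n = i div n ^ k mod n"
proof -
  have "n ^ l \<noteq> 0" using assms by (metis not_less_zero)
  then have "(i * n ^ l + j) div n ^ l = i" using assms by simp
  then show ?thesis by (simp only: power_add div_mult2_eq)
qed

lemma digits_9:
  assumes "i < n ^ 4" "j < n ^ 4" "p < n"
  defines "v \<equiv> digits n 9 (p * n ^ 8 + (i * n ^ 4 + j))"
  shows "world_at v 0 = coordinates n j" "world_at v 4 = coordinates n i" "v ! 8 = p"
proof -
  have ij: "i * n ^ 4 + j < n ^ 8" using digit_less[OF assms(1,2)] by (simp flip: power_add)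
  have "v ! k = j div n ^ k mod n" if "k < 4" for k
    using that unfolding v_def by (simp add: digit_low)
  then show "world_at v 0 = coordinates n j" by (simp add: world_at_0 coordinates_def)
  have "v ! (4 + k) = i div n ^ k mod n" if "k < 4" for k
    using that digit_high[OF assms(2), of i k] unfolding v_def by (simp add: digit_low)
  from this[of 0] this[of 1] this[of 2] this[of 3]
  show "world_at v 4 = coordinates n i" by (simp add: world_at_4 coordinates_def)
  show "v ! 8 = p" using digit_high[OF ij, of p 0] assms(3) unfolding v_def by simp
qed

lemma coordinates_zero: "u < n ^ 4 \<Longrightarrow> coordinates n u = (0, 0, 0, 0) \<longleftrightarrow> u = 0"
  using world_number_coordinates[of u n] by (auto simp: coordinates_def)

lemma concat_map_if_zero:
  assumes "0 < n" shows "concat (map (\<lambda>i. if i = (0::nat) then xs else []) [0..<n]) = xs"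
proof -
  have "[0..<n] = 0 # [1..<n]" using assms upt_conv_Cons by simp
  moreover have "concat (map (\<lambda>i. if i = (0::nat) then xs else []) [1..<n]) = []" by simp
  ultimately show ?thesis by simp
qed

text \<open>The most significant digit runs through all values below \<open>n\<close>. The values 0
  to 4 select the five blocks of the encoding and larger ones emit nothing, whence
  \<open>5 \<le> n\<close>.\<close>

lemma concat_encoding_bits:
  assumes "5 \<le> n"
  shows "concat (map (\<lambda>m. emit (encoding_bit M (digits n 9 m) (read_input x (digits n 9 m ! (9 - 2) + 1))))
      [0..<n ^ 9]) = encode_frame (horn_frame M x n)" (is "concat (map ?f _) = _")
proof -
  let ?N = "n ^ 4"
  let ?g = "\<lambda>p i j. ?f (p * n ^ 8 + (i * ?N + j))"
  let ?part = "\<lambda>p. concat (map (\<lambda>i. concat (map (?g p i) [0..<?N])) [0..<?N])"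
  have N: "0 < ?N" using assms by simp
  have "concat (map ?f [0..<n ^ 9]) = concat (map (\<lambda>p. concat (map (\<lambda>q. ?f (p * n ^ 8 + q)) [0..<n ^ 8])) [0..<n])"
    using concat_map_upt_mult[of ?f n "n ^ 8"] by (simp flip: power_Suc)
  also have "\<dots> = concat (map ?part [0..<n])"
    using concat_map_upt_mult[of "\<lambda>q. ?f (_ * n ^ 8 + q)" ?N ?N] by (simp flip: power_add)
  also have "[0..<n] = [0, 1, 2, 3, 4] @ [5..<n]"
    using upt_add_eq_append[of 0 5 "n - 5"] assms by (simp add: upt_rec)
  also have "concat (map ?part ([0, 1, 2, 3, 4] @ [5..<n])) = ?part 0 @ ?part 1 @ ?part 2 @ ?part 3 @ ?part 4 @ concat (map ?part [5..<n])"
    by simp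
  finally have split: "concat (map ?f [0..<n ^ 9]) =
    ?part 0 @ ?part 1 @ ?part 2 @ ?part 3 @ ?part 4 @ concat (map ?part [5..<n])" .
  have rest: "concat (map ?part [5..<n]) = []"
    using digits_9 by (auto simp: encoding_bit_def)
  have part0: "?part 0 = replicate ?N True"
  proof -
    have "?part 0 = concat (map (\<lambda>i. if i = 0 then replicate ?N True else []) [0..<?N])"
    proof (intro arg_cong[where f = concat] map_cong refl)
      fix i assume "i \<in> set [0..<?N]"
      then have i: "i < ?N" by simp
      have "?g 0 i j = (if i = 0 then [True] else [])" if "j < ?N" for j
        using digits_9[OF i that, of 0] coordinates_zero[OF i] assms by (simp add: encoding_bit_def)
      then have "map (?g 0 i) [0..<?N] = map (\<lambda>_. if i = 0 then [True] else []) [0..<?N]" by simp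
      then show "concat (map (?g 0 i) [0..<?N]) = (if i = 0 then replicate ?N True else [])"
        by (simp add: map_replicate_const concat_replicate_trivial)
    qed
    then show ?thesis using concat_map_if_zero[OF N] by simp
  qed
  have part1: "?part 1 = [False]"
  proof -
    have "?part 1 = concat (map (\<lambda>i. if i = 0 then [False] else []) [0..<?N])"
    proof (intro arg_cong[where f = concat] map_cong refl)
      fix i assume "i \<in> set [0..<?N]"
      then have i: "i < ?N" by simp
      have "?g 1 i j = (if j = 0 then if i = 0 then [False] else [] else [])" if "j < ?N" for j
        using digits_9[OF i that, of 1] coordinates_zero[OF i] coordinates_zero[OF that] assms
        by (simp add: encoding_bit_def)
      then have eq: "map (?g 1 i) [0..<?N] = map (\<lambda>j. if j = 0 then if i = 0 then [False] else [] else []) [0..<?N]"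
        by simp
      show "concat (map (?g 1 i) [0..<?N]) = (if i = 0 then [False] else [])"
        unfolding eq by (rule concat_map_if_zero[OF N])
    qed
    then show ?thesis using concat_map_if_zero[OF N] by simp
  qed
  have matrix: "?part p = matrix_bits ?N (acc (horn_frame M x n) m)"
    if "(p, m) \<in> {(2, Base), (3, Plus), (4, Minus)}" for p m
    unfolding matrix_bits_def
  proof (intro arg_cong[where f = concat] map_cong refl)
    fix i assume "i \<in> set [0..<?N]"
    then have i: "i < ?N" by simp
    have "?g p i j = [(i, j) \<in> acc (horn_frame M x n) m]" if j: "j < ?N" for j
    proof -
      let ?v = "digits n 9 (p * n ^ 8 + (i * ?N + j))"
      have p: "p < n" using that assms \<open>(p, m) \<in> _\<close> by auto
      note d = digits_9[OF i j p]
      \<comment> \<open>The track followed by the input head is the position of the row world, so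
        the symbol read is the one that \<open>related\<close> asks for.\<close>
      have "?v ! (9 - 2) = fst (coordinates n i)" unfolding d(2)[symmetric] by (simp add: world_at_def)
      then have "?g p i j = emit (encoding_bit M ?v (read_input x (Suc (fst (coordinates n i)))))" by simp
      also have "\<dots> = [related M x m (coordinates n i) (coordinates n j)]"
        using \<open>(p, m) \<in> _\<close> unfolding encoding_bit_def d by (auto simp del: linked.simps)
      finally show ?thesis using i j by (simp add: horn_frame_def)
    qed
    then have "map (?g p i) [0..<?N] = map (\<lambda>j. [(i, j) \<in> acc (horn_frame M x n) m]) [0..<?N]" by simp
    then show "concat (map (?g p i) [0..<?N]) = map (\<lambda>j. (i, j) \<in> acc (horn_frame M x n) m) [0..<?N]"
      by (simp only: concat_map_singleton)
  qed
  have "card (worlds (horn_frame M x n)) = ?N" by (simp add: horn_frame_def)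
  then have "encode_frame (horn_frame M x n) = replicate ?N True @ [False] @
      matrix_bits ?N (acc (horn_frame M x n) Base) @ matrix_bits ?N (acc (horn_frame M x n) Plus) @
      matrix_bits ?N (acc (horn_frame M x n) Minus)"
    by (simp only: encode_frame_def Let_def)
  moreover have "?part 2 = matrix_bits ?N (acc (horn_frame M x n) Base)"
    "?part 3 = matrix_bits ?N (acc (horn_frame M x n) Plus)"
    "?part 4 = matrix_bits ?N (acc (horn_frame M x n) Minus)"
    by (rule matrix; simp)+
  ultimately show ?thesis unfolding split by (simp only: part0 part1 rest append_Nil2)
qed

section \<open>Unique decoding\<close>

lemma matrix_bits_inj:
  assumes "matrix_bits n r = matrix_bits n r'" "r \<subseteq> {..<n} \<times> {..<n}" "r' \<subseteq> {..<n} \<times> {..<n}"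
  shows "r = r'"
proof -
  have "map (\<lambda>i. map (\<lambda>j. (i, j) \<in> r) [0..<n]) [0..<n] = map (\<lambda>i. map (\<lambda>j. (i, j) \<in> r') [0..<n]) [0..<n]"
    using assms(1) unfolding matrix_bits_def
    by (subst (asm) concat_eq_concat_iff) (auto simp: set_zip)
  then have "\<forall>i<n. \<forall>j<n. (i, j) \<in> r \<longleftrightarrow> (i, j) \<in> r'" by simp
  then show ?thesis using assms(2,3) by auto
qed

lemma length_matrix_bits: "length (matrix_bits n r) = n * n"
  by (simp add: matrix_bits_def length_concat comp_def sum_list_triv)

text \<open>Membership in \<open>finite_frame_validity\<close> only asserts that some valid frame
  has the given code; injectivity identifies that frame. \<open>is_frame\<close> matters because
  pairs outside the worlds leave no trace in the code.\<close>

lemma encode_frame_inj: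
  assumes "encode_frame F = encode_frame G" "is_frame F" "is_frame G"
    "worlds F = {..<m}" "worlds G = {..<n}"
  shows "F = G"
proof -
  have "takeWhile id (encode_frame F) = replicate m True" "takeWhile id (encode_frame G) = replicate n True"
    using assms(4,5) by (simp_all add: encode_frame_def takeWhile_append)
  then have mn: "m = n" using assms(1) by (metis length_replicate)
  have "acc F k \<subseteq> {..<n} \<times> {..<n}" "acc G k \<subseteq> {..<n} \<times> {..<n}" for k
    using assms(2-5) mn unfolding is_frame_def by auto
  moreover have "matrix_bits n (acc F k) = matrix_bits n (acc G k)" for k
    using assms(1,4,5) mn by (cases k) (auto simp: encode_frame_def length_matrix_bits)
  ultimately have "acc F k = acc G k" for k by (metis matrix_bits_inj)
  then show ?thesis using assms(4,5) mn by (cases F, cases G) (auto simp: fun_eq_iff)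
qed

lemma finite_frame_validity_iff:
  assumes "is_frame F" "worlds F = {..<n}"
  shows "encode_frame F \<in> finite_frame_validity \<phi> \<longleftrightarrow> validates F \<phi>"
  using assms encode_frame_inj unfolding finite_frame_validity_def by blast

theorem theorem5p13:
  fixes t :: nat
  shows "P_hard (finite_frame_validity (phi_h t))"
  unfolding P_hard_def
proof
  fix A assume "A \<in> class_P"
  then obtain M c d where M: "is_tm M" and dec: "tm_decides_in_time M A (\<lambda>n. c * n ^ d + c)"
    unfolding class_P_def by blast
  obtain e where e: "\<And>\<tau>. \<tau> \<in> tags M \<Longrightarrow> to_nat \<tau> < e"
    using finite_nat_set_iff_bounded[of "to_nat ` tags M"] finite_tags[OF M] by auto
  \<comment> \<open>One summand per factor that \<open>(2 ^ l x) ^ b\<close> must dominate: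
    \<open>d\<close> for the power of the input length, \<open>2 * c\<close> for both occurrences of
    \<open>c\<close> in the time bound, \<open>e\<close> for the tag codes and 2 for the bound
    5.\<close>
  define b where "b = d + 2 * c + e + 2"
  have "2 \<le> (2::nat) ^ b" unfolding b_def by simp
  then obtain l where l: "\<And>x. length x + 2 < 2 ^ l x"
    and f: "logspace_computable (\<lambda>x. concat (map (\<lambda>m. emit (encoding_bit M (digits ((2 ^ b) ^ l x) 9 m)
      (read_input x (digits ((2 ^ b) ^ l x) 9 m ! (9 - 2) + 1)))) [0..<((2 ^ b) ^ l x) ^ 9]))"
    using enumeration_logspace[OF _ _ regular_encoding_bit[OF M], of "2 ^ b"] by auto
  define n where "n x = ((2::nat) ^ b) ^ l x" for x
  have n: "5 \<le> n x" "e \<le> n x" "c * length x ^ d + c < n x" for x :: "bool list"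
  proof -
    define y where "y = (2::nat) ^ l x"
    have y: "length x \<le> y" "3 \<le> y" using l[of x] unfolding y_def by auto
    \<comment> \<open>Exchanging the exponents shows \<open>n x\<close> as a fixed power of
      \<open>y\<close>, which exceeds the input length; each required bound is then met by one or
      two of its factors.\<close>
    have "n x = y ^ b" unfolding n_def y_def by (simp flip: power_mult add: mult.commute)
    then have ny: "n x = y ^ d * y ^ (2 * c) * y ^ e * y ^ 2" by (simp only: b_def power_add)
    have pow: "k < y ^ k" for k
      using less_le_trans[OF less_exp power_mono[of 2 y k]] y by simp
    have pos: "1 \<le> y ^ k" for k using y by simp
    have sq: "9 \<le> y ^ 2" using power_mono[OF y(2), of 2] by simp
    have "1 * 1 * 1 * 9 \<le> n x" unfolding ny by (intro mult_le_mono pos sq)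
    then show "5 \<le> n x" by simp
    have "1 * 1 * y ^ e * 1 \<le> n x" unfolding ny by (intro mult_le_mono pos) simp
    then show "e \<le> n x" using pow[of e] by simp
    have "c * length x ^ d + c \<le> c * y ^ d + c * y ^ d"
      by (intro add_mono mult_le_mono power_mono y) (use pos[of d] in auto)
    also have "\<dots> = y ^ d * (2 * c)" by simp
    also have "\<dots> < y ^ d * y ^ (2 * c)" using pow[of "2 * c"] pos[of d] y by simp
    also have "\<dots> * 1 * 1 \<le> n x" unfolding ny by (intro mult_le_mono pos order_refl)
    finally show "c * length x ^ d + c < n x" by simp
  qed
  have "logspace_computable (\<lambda>x. encode_frame (horn_frame M x (n x)))"
    using f n(1) unfolding n_def[symmetric] by (simp only: concat_encoding_bits)
  moreover have "x \<in> A \<longleftrightarrow> encode_frame (horn_frame M x (n x)) \<in> finite_frame_validity (phi_h t)" for x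
  proof -
    obtain k where k: "k \<le> c * length x ^ d + c"
      "tc_state ((tm_step M ^^ k) (tm_init M x)) = (if x \<in> A then tm_accept M else tm_reject M)"
      using dec unfolding tm_decides_in_time_def by blast
    have "0 < n x" using n(1)[of x] by simp
    moreover have "worlds (horn_frame M x (n x)) = {..<n x ^ 4}" by (simp add: horn_frame_def)
    moreover have "validates (horn_frame M x (n x)) (phi_h t) \<longleftrightarrow> x \<in> A"
      by (rule validates_horn_frame_iff[OF M])
        (use k n[of x] e in \<open>auto simp: config_def intro: less_le_trans\<close>)
    ultimately show ?thesis using finite_frame_validity_iff[OF is_frame_horn_frame] by blast
  qed
  ultimately show "logspace_reducible A (finite_frame_validity (phi_h t))"
    unfolding logspace_reducible_def by blast
qed

end
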